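(* Each of the following nilpotent Lie algebras over $\mathbb{C}$ is realized by pseudo-bosonic operators: (i) (corank $0$) every finite dimensional abelian Lie algebra; (ii) (corank $1$) $\mathfrak{h}(1)$; (iii) (corank $2$) $\mathfrak{l}_{4,2}=\mathfrak{h}(1)\oplus\mathfrak{i}$; (iv) (corank $3$) $\mathfrak{l}_{5,2}=\mathfrak{l}_{4,2}\oplus\mathfrak{i}$; (v) (corank $4$) $\mathfrak{l}_{5,2}\oplus\mathfrak{i}$, $\mathfrak{l}_{4,3}$, and $\mathfrak{l}_{5,8}$; (vi) (corank $5$) $\mathfrak{l}_{7,2}=\mathfrak{l}_{5,2}\oplus\mathfrak{i}\oplus\mathfrak{i}$ and $\mathfrak{h}(2)$; (vii) (corank $6$) $\mathfrak{l}_{4,3}\oplus\mathfrak{i}$, $\mathfrak{l}_{5,5}$, $\mathfrak{h}(2)\oplus\mathfrak{i}$, $\mathfrak{l}_{5,8}\oplus\mathfrak{i}$, and $\mathfrak{l}_{8,2}=\mathfrak{l}_{7,2}\oplus\mathfrak{i}$.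
   Context: All Lie algebras are finite dimensional over $\mathbb{C}$. The corank of a nilpotent Lie algebra $\mathfrak{l}$ of dimension $n$ is $t(\mathfrak{l})=\frac12 n(n-1)-\dim M(\mathfrak{l})$, where $M(\mathfrak{l})=H^2(\mathfrak{l},\mathbb{C})$ (trivial coefficients) is the Schur multiplier; the coranks in the claim only label the cases. Notation (basis elements listed; all brackets of basis elements not determined by the listed ones and antisymmetry are zero): $\mathfrak{i}$ is the $1$-dimensional abelian Lie algebra; $\mathfrak{h}(m)$ is the Heisenberg algebra of dimension $2m+1$ with basis $v_1,\dots,v_{2m},v$ and $[v_{2i-1},v_{2i}]=v$ for $i=1,\dots,m$; $\mathfrak{l}_{4,3}=\langle v_1,\dots,v_4 \mid [v_1,v_2]=v_3,\ [v_1,v_3]=v_4\rangle$; $\mathfrak{l}_{5,5}=\langle v_1,\dots,v_5\mid [v_1,v_2]=v_3,\ [v_1,v_3]=[v_2,v_4]=v_5\rangle$; $\mathfrak{l}_{5,8}=\langle v_1,\dots,v_5\mid [v_1,v_2]=v_4,\ [v_1,v_3]=v_5\rangle$. Pseudo-bosonic operators: let $\mathcal{H}$ be a complex Hilbert space and $\mathcal{D}\subseteq\mathcal{H}$ a dense subspace. A family of ($d$-mode) pseudo-bosonic operators consists of pairs $(a_j,b_j)$, $j=1,\dots,d$, of (possibly unbounded) densely defined operators on $\mathcal{H}$ with adjoints $a_j^\dagger,b_j^\dagger$, such that $\mathcal{D}$ is contained in the domains of $a_j,b_j,a_j^\dagger,b_j^\dagger$ and is mapped into itself by all of them, and such that on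 $\mathcal{D}$ one has $[a_j,b_k]=\delta_{j,k}\mathbb{I}$ and $[a_j,a_k]=[b_j,b_k]=0$ for all $j,k$. Bosonic operators are the particular case $b_j=a_j^\dagger$ (on $\mathcal{D}$). A Lie algebra $\mathfrak{l}$ is realized by pseudo-bosonic operators if, for some complex Hilbert space $\mathcal{H}$, some dense subspace $\mathcal{D}\subseteq\mathcal{H}$, some integer $d\ge 1$ and some family $(a_j,b_j)$, $j=1,\dots,d$, of $d$-mode pseudo-bosonic operators on $\mathcal{H}$ with respect to $\mathcal{D}$, $\mathfrak{l}$ is isomorphic to a Lie subalgebra, with respect to the commutator $[x,y]=xy-yx$, of the associative algebra of linear operators $\mathcal{D}\to\mathcal{D}$ generated by $\mathbb{I}$ and by the $a_j,b_j$, $j=1,\dots,d$. *)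

theory Defs
  imports "HOL-Analysis.Analysis" "HOL-Library.Function_Algebras" "HOL-Library.Product_Plus"
begin

section \<open>Complex Lie algebras\<close>

text \<open>A Lie algebra lives on a subspace \<open>carr L\<close> of an ambient complex vector space, whose
  addition comes from the type class and whose scalar multiplication is \<open>scal L\<close>.\<close>

record 'a lie_alg =
  carr :: "'a set"
  scal :: "complex \<Rightarrow> 'a \<Rightarrow> 'a"
  brk :: "'a \<Rightarrow> 'a \<Rightarrow> 'a"

locale lie_algebra = vector_space "scal L" for L :: "'a::ab_group_add lie_alg" +
  assumes subspace_carr: "subspace (carr L)"
    and brk_closed: "\<lbrakk>x \<in> carr L; y \<in> carr L\<rbrakk> \<Longrightarrow> brk L x y \<in> carr L"
    and brk_add_left: "\<lbrakk>x \<in> carr L; y \<in> carr L; z \<in> carr L\<rbrakk>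
      \<Longrightarrow> brk L (x + y) z = brk L x z + brk L y z"
    and brk_add_right: "\<lbrakk>x \<in> carr L; y \<in> carr L; z \<in> carr L\<rbrakk>
      \<Longrightarrow> brk L x (y + z) = brk L x y + brk L x z"
    and brk_scale_left: "\<lbrakk>x \<in> carr L; y \<in> carr L\<rbrakk>
      \<Longrightarrow> brk L (scal L c x) y = scal L c (brk L x y)"
    and brk_scale_right: "\<lbrakk>x \<in> carr L; y \<in> carr L\<rbrakk>
      \<Longrightarrow> brk L x (scal L c y) = scal L c (brk L x y)"
    and brk_self: "x \<in> carr L \<Longrightarrow> brk L x x = 0"
    and jacobi: "\<lbrakk>x \<in> carr L; y \<in> carr L; z \<in> carr L\<rbrakk>
      \<Longrightarrow> brk L x (brk L y z) + brk L y (brk L z x) + brk L z (brk L x y) = 0"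

definition lie_finite_dimensional :: "'a::ab_group_add lie_alg \<Rightarrow> bool" where
  "lie_finite_dimensional L \<longleftrightarrow> (\<exists>B. finite B \<and> module.span (scal L) B = carr L)"

definition lie_abelian :: "'a::ab_group_add lie_alg \<Rightarrow> bool" where
  "lie_abelian L \<longleftrightarrow> (\<forall>x\<in>carr L. \<forall>y\<in>carr L. brk L x y = 0)"

definition lie_isomorphic :: "'a::ab_group_add lie_alg \<Rightarrow> 'b::ab_group_add lie_alg \<Rightarrow> bool" where
  "lie_isomorphic L M \<longleftrightarrow> (\<exists>\<phi>. bij_betw \<phi> (carr L) (carr M) \<and>
     (\<forall>x\<in>carr L. \<forall>y\<in>carr L. \<phi> (x + y) = \<phi> x + \<phi> y) \<and>
     (\<forall>c. \<forall>x\<in>carr L. \<phi> (scal L c x) = scal M c (\<phi> x)) \<and>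
     (\<forall>x\<in>carr L. \<forall>y\<in>carr L. \<phi> (brk L x y) = brk M (\<phi> x) (\<phi> y)))"

definition lie_subalgebra :: "'a::ab_group_add set \<Rightarrow> 'a lie_alg \<Rightarrow> bool" where
  "lie_subalgebra S L \<longleftrightarrow> S \<subseteq> carr L \<and> module.subspace (scal L) S \<and>
     (\<forall>x\<in>S. \<forall>y\<in>S. brk L x y \<in> S)"

definition lie_sum ::
    "'a::ab_group_add lie_alg \<Rightarrow> 'b::ab_group_add lie_alg \<Rightarrow> ('a \<times> 'b) lie_alg"
    (infixl "\<oplus>\<^sub>L" 65) where
  "L \<oplus>\<^sub>L M = \<lparr> carr = carr L \<times> carr M,
     scal = (\<lambda>c p. (scal L c (fst p), scal M c (snd p))),
     brk = (\<lambda>p q. (brk L (fst p) (fst q), brk M (snd p) (snd q))) \<rparr>"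


section \<open>Lie algebras given by a table of brackets\<close>

text \<open>The underlying space has basis \<open>v 1, \<dots>, v n\<close>, realised as the unit vectors of the space of
  sequences supported in \<open>{1..n}\<close>. A triple \<open>(i, j, l)\<close> in the table \<open>T\<close> stands for
  \<open>[v i, v j] = v l\<close>; it also determines \<open>[v j, v i]\<close>, and brackets not determined by
  \<open>T\<close> vanish.\<close>

definition table_alg :: "nat \<Rightarrow> (nat \<times> nat \<times> nat) set \<Rightarrow> (nat \<Rightarrow> complex) lie_alg" where
  "table_alg n T = \<lparr> carr = {x. \<forall>i. i \<notin> {1..n} \<longrightarrow> x i = 0},
     scal = (\<lambda>c x i. c * x i),
     brk = (\<lambda>x y k. \<Sum>(i, j, l)\<in>T. if l = k then x i * y j - x j * y i else 0) \<rparr>"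

definition lie_i :: "(nat \<Rightarrow> complex) lie_alg" where
  "lie_i = table_alg 1 {}"

definition lie_h :: "nat \<Rightarrow> (nat \<Rightarrow> complex) lie_alg" where
  "lie_h m = table_alg (2 * m + 1) ((\<lambda>i. (2 * i - 1, 2 * i, 2 * m + 1)) ` {1..m})"

definition lie_l43 :: "(nat \<Rightarrow> complex) lie_alg" where
  "lie_l43 = table_alg 4 {(1, 2, 3), (1, 3, 4)}"

definition lie_l55 :: "(nat \<Rightarrow> complex) lie_alg" where
  "lie_l55 = table_alg 5 {(1, 2, 3), (1, 3, 5), (2, 4, 5)}"

definition lie_l58 :: "(nat \<Rightarrow> complex) lie_alg" where
  "lie_l58 = table_alg 5 {(1, 2, 4), (1, 3, 5)}"

definition "lie_l42 = lie_h 1 \<oplus>\<^sub>L lie_i"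
definition "lie_l52 = lie_l42 \<oplus>\<^sub>L lie_i"
definition "lie_l72 = lie_l52 \<oplus>\<^sub>L lie_i \<oplus>\<^sub>L lie_i"
definition "lie_l82 = lie_l72 \<oplus>\<^sub>L lie_i"

lemma lie_algebra_table_alg:
  assumes T: "\<And>i j l. (i, j, l) \<in> T \<Longrightarrow> l \<in> {1..n}"
    and jac: "\<And>x y z. \<lbrakk>x \<in> carr (table_alg n T); y \<in> carr (table_alg n T);
      z \<in> carr (table_alg n T)\<rbrakk> \<Longrightarrow>
      brk (table_alg n T) x (brk (table_alg n T) y z) +
      brk (table_alg n T) y (brk (table_alg n T) z x) +
      brk (table_alg n T) z (brk (table_alg n T) x y) = 0"
  shows "lie_algebra (table_alg n T)"
proof -
  interpret vector_space "scal (table_alg n T)"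
    by unfold_locales (auto simp: table_alg_def fun_eq_iff algebra_simps)
  show ?thesis
  proof
    show "subspace (carr (table_alg n T))"
      unfolding subspace_def by (auto simp: table_alg_def)
    show "brk (table_alg n T) x y \<in> carr (table_alg n T)" for x y
      using T by (auto simp: table_alg_def split: prod.splits intro!: sum.neutral)
  next
    show "brk (table_alg n T) x x = 0" for x
      by (auto simp: table_alg_def fun_eq_iff intro!: sum.neutral)
  qed (use jac in \<open>auto simp: table_alg_def fun_eq_iff algebra_simps sum_distrib_left
        split: prod.splits simp flip: sum.distrib intro!: sum.cong\<close>)
qed

lemma lie_algebra_i: "lie_algebra lie_i"
  unfolding lie_i_def by (rule lie_algebra_table_alg) (auto simp: table_alg_def fun_eq_iff)

lemma lie_algebra_l43: "lie_algebra lie_l43"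
  unfolding lie_l43_def
  by (rule lie_algebra_table_alg) (auto simp: table_alg_def fun_eq_iff algebra_simps)

lemma lie_algebra_l55: "lie_algebra lie_l55"
  unfolding lie_l55_def
  by (rule lie_algebra_table_alg) (auto simp: table_alg_def fun_eq_iff algebra_simps)

lemma lie_algebra_l58: "lie_algebra lie_l58"
  unfolding lie_l58_def
  by (rule lie_algebra_table_alg) (auto simp: table_alg_def fun_eq_iff algebra_simps)

lemma lie_algebra_h: "lie_algebra (lie_h m)"
proof -
  let ?T = "(\<lambda>i. (2 * i - 1, 2 * i, 2 * m + 1)) ` {1..m}"
  let ?L = "table_alg (2 * m + 1) ?T"
  have "brk ?L x (brk ?L y z) = 0" for x y z
  proof
    fix k
    have *: "brk ?L y z i = 0" if "i \<noteq> 2 * m + 1" for i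
      using that by (auto simp: table_alg_def intro!: sum.neutral)
    have "brk ?L x w k = 0" if "\<And>i. i \<noteq> 2 * m + 1 \<Longrightarrow> w i = 0" for w
      unfolding table_alg_def using that by (auto intro!: sum.neutral)
    then show "brk ?L x (brk ?L y z) k = 0 k"
      using * by simp
  qed
  then show ?thesis
    unfolding lie_h_def by (intro lie_algebra_table_alg) auto
qed

lemma lie_algebra_sum:
  assumes "lie_algebra L" "lie_algebra M"
  shows "lie_algebra (L \<oplus>\<^sub>L M)"
proof -
  interpret L: lie_algebra L by fact
  interpret M: lie_algebra M by fact
  interpret vector_space "scal (L \<oplus>\<^sub>L M)"
    by unfold_locales
      (auto simp: lie_sum_def L.scale_right_distrib L.scale_left_distrib
        M.scale_right_distrib M.scale_left_distrib)
  show ?thesis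
  proof
    show "subspace (carr (L \<oplus>\<^sub>L M))"
      using L.subspace_carr M.subspace_carr
      unfolding subspace_def L.subspace_def M.subspace_def by (auto simp: lie_sum_def zero_prod_def)
  qed (auto simp: lie_sum_def L.brk_closed M.brk_closed L.brk_add_left M.brk_add_left
        L.brk_add_right M.brk_add_right L.brk_scale_left M.brk_scale_left L.brk_scale_right
        M.brk_scale_right L.brk_self M.brk_self L.jacobi M.jacobi zero_prod_def)
qed


section \<open>Hilbert spaces and unbounded operators\<close>

text \<open>An inner product space is a subspace \<open>H\<close> of an ambient complex vector space, with an inner
  product that is linear in its second argument.\<close>

locale complex_inner_product_space = vector_space smul
  for smul :: "complex \<Rightarrow> 'h::ab_group_add \<Rightarrow> 'h" +
  fixes H :: "'h set" and ip :: "'h \<Rightarrow> 'h \<Rightarrow> complex"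
  assumes subspace_H: "subspace H"
    and ip_add_right: "\<lbrakk>x \<in> H; y \<in> H; z \<in> H\<rbrakk> \<Longrightarrow> ip x (y + z) = ip x y + ip x z"
    and ip_scale_right: "\<lbrakk>x \<in> H; y \<in> H\<rbrakk> \<Longrightarrow> ip x (smul c y) = c * ip x y"
    and ip_commute: "\<lbrakk>x \<in> H; y \<in> H\<rbrakk> \<Longrightarrow> ip y x = cnj (ip x y)"
    and ip_pos: "\<lbrakk>x \<in> H; x \<noteq> 0\<rbrakk> \<Longrightarrow> 0 < Re (ip x x)"
begin

definition hnorm :: "'h \<Rightarrow> real" where
  "hnorm x = sqrt (Re (ip x x))"

definition dense_in_H :: "'h set \<Rightarrow> bool" where
  "dense_in_H S \<longleftrightarrow> S \<subseteq> H \<and> (\<forall>x\<in>H. \<forall>e>0. \<exists>y\<in>S. hnorm (x - y) < e)"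

end

locale complex_hilbert_space = complex_inner_product_space smul H ip
  for smul :: "complex \<Rightarrow> 'h::ab_group_add \<Rightarrow> 'h" and H ip +
  assumes complete: "\<And>X :: nat \<Rightarrow> 'h. \<lbrakk>\<And>n. X n \<in> H;
      \<And>e. 0 < e \<Longrightarrow> \<exists>N. \<forall>m\<ge>N. \<forall>n\<ge>N. hnorm (X m - X n) < e\<rbrakk>
      \<Longrightarrow> \<exists>l\<in>H. (\<lambda>n. hnorm (X n - l)) \<longlonglongrightarrow> 0"

record 'h unbounded_op =
  op_dom :: "'h set"
  op_app :: "'h \<Rightarrow> 'h"

context complex_hilbert_space
begin

definition densely_defined :: "'h unbounded_op \<Rightarrow> bool" where
  "densely_defined A \<longleftrightarrow> subspace (op_dom A) \<and> dense_in_H (op_dom A) \<and>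
     op_app A ` op_dom A \<subseteq> H \<and>
     (\<forall>x\<in>op_dom A. \<forall>y\<in>op_dom A. op_app A (x + y) = op_app A x + op_app A y) \<and>
     (\<forall>c. \<forall>x\<in>op_dom A. op_app A (smul c x) = smul c (op_app A x))"

definition adjoint_op :: "'h unbounded_op \<Rightarrow> 'h unbounded_op" where
  "adjoint_op A = \<lparr>
     op_dom = {y \<in> H. \<exists>z\<in>H. \<forall>x\<in>op_dom A. ip y (op_app A x) = ip z x},
     op_app = (\<lambda>y. THE z. z \<in> H \<and> (\<forall>x\<in>op_dom A. ip y (op_app A x) = ip z x)) \<rparr>"

definition preserves :: "'h set \<Rightarrow> 'h unbounded_op \<Rightarrow> bool" where
  "preserves D A \<longleftrightarrow> D \<subseteq> op_dom A \<and> op_app A ` D \<subseteq> D"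

definition commutes_to :: "'h set \<Rightarrow> 'h unbounded_op \<Rightarrow> 'h unbounded_op \<Rightarrow> complex \<Rightarrow> bool" where
  "commutes_to D A B c \<longleftrightarrow>
     (\<forall>x\<in>D. op_app A (op_app B x) - op_app B (op_app A x) = smul c x)"

definition pseudo_bosonic ::
    "'h set \<Rightarrow> nat \<Rightarrow> (nat \<Rightarrow> 'h unbounded_op) \<Rightarrow> (nat \<Rightarrow> 'h unbounded_op) \<Rightarrow> bool" where
  "pseudo_bosonic D d a b \<longleftrightarrow>
     (\<forall>j\<in>{1..d}. densely_defined (a j) \<and> densely_defined (b j) \<and>
        preserves D (a j) \<and> preserves D (b j) \<and>
        preserves D (adjoint_op (a j)) \<and> preserves D (adjoint_op (b j))) \<and>
     (\<forall>j\<in>{1..d}. \<forall>k\<in>{1..d}.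
        commutes_to D (a j) (b k) (if j = k then 1 else 0) \<and>
        commutes_to D (a j) (a k) 0 \<and> commutes_to D (b j) (b k) 0)"

end

text \<open>A linear operator \<open>D \<rightarrow> D\<close> is encoded as a function that vanishes off \<open>D\<close>, so that equality of
  operators is equality of functions, and sums and composites are the pointwise sum and \<open>(\<circ>)\<close>.\<close>

definition restrict_op :: "'h set \<Rightarrow> ('h \<Rightarrow> 'h) \<Rightarrow> 'h \<Rightarrow> 'h::zero" where
  "restrict_op D f = (\<lambda>x. if x \<in> D then f x else 0)"

inductive_set op_algebra ::
    "(complex \<Rightarrow> 'h \<Rightarrow> 'h) \<Rightarrow> 'h set \<Rightarrow> ('h \<Rightarrow> 'h) set \<Rightarrow> ('h \<Rightarrow> 'h::ab_group_add) set"
  for smul :: "complex \<Rightarrow> 'h \<Rightarrow> 'h" and D :: "'h set" and G :: "('h \<Rightarrow> 'h) set" where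
  one: "restrict_op D id \<in> op_algebra smul D G"
| gen: "f \<in> G \<Longrightarrow> restrict_op D f \<in> op_algebra smul D G"
| add: "\<lbrakk>f \<in> op_algebra smul D G; g \<in> op_algebra smul D G\<rbrakk> \<Longrightarrow> f + g \<in> op_algebra smul D G"
| smult: "f \<in> op_algebra smul D G \<Longrightarrow> (\<lambda>x. smul c (f x)) \<in> op_algebra smul D G"
| comp: "\<lbrakk>f \<in> op_algebra smul D G; g \<in> op_algebra smul D G\<rbrakk> \<Longrightarrow> f \<circ> g \<in> op_algebra smul D G"

definition pb_lie_algebra ::
    "(complex \<Rightarrow> 'h \<Rightarrow> 'h) \<Rightarrow> 'h set \<Rightarrow> nat \<Rightarrow> (nat \<Rightarrow> 'h unbounded_op) \<Rightarrow> (nat \<Rightarrow> 'h unbounded_op)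
      \<Rightarrow> ('h \<Rightarrow> 'h::ab_group_add) lie_alg" where
  "pb_lie_algebra smul D d a b = \<lparr>
     carr = op_algebra smul D ((\<lambda>j. op_app (a j)) ` {1..d} \<union> (\<lambda>j. op_app (b j)) ` {1..d}),
     scal = (\<lambda>c f x. smul c (f x)),
     brk = (\<lambda>f g. (f \<circ> g) - (g \<circ> f)) \<rparr>"

context complex_hilbert_space
begin

lemma op_algebra_linear:
  fixes D :: "'h set"
  assumes D: "subspace D"
    and G: "\<And>f. f \<in> G \<Longrightarrow> f ` D \<subseteq> D"
      "\<And>f x y. \<lbrakk>f \<in> G; x \<in> D; y \<in> D\<rbrakk> \<Longrightarrow> f (x + y) = f x + f y"
      "\<And>f x c. \<lbrakk>f \<in> G; x \<in> D\<rbrakk> \<Longrightarrow> f (smul c x) = smul c (f x)"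
    and f: "f \<in> op_algebra smul D G"
  shows "f ` D \<subseteq> D \<and> (\<forall>x\<in>D. \<forall>y\<in>D. f (x + y) = f x + f y) \<and>
    (\<forall>c. \<forall>x\<in>D. f (smul c x) = smul c (f x)) \<and> (\<forall>x. x \<notin> D \<longrightarrow> f x = 0)"
  using f
proof induction
  case one
  show ?case using D by (auto simp: restrict_op_def subspace_def)
next
  case (gen f)
  then show ?case using D G by (auto simp: restrict_op_def subspace_def)
next
  case (add f g)
  then show ?case using D by (auto simp: subspace_def algebra_simps image_subset_iff)
next
  case (smult f c)
  then show ?case
    using D by (auto simp: subspace_def image_subset_iff scale_right_distrib mult.commute)
next
  case (comp f g)
  have "f 0 = 0" using comp.IH(1) D by (metis scale_zero_left subspace_def)
  with comp show ?case by (auto simp: image_subset_iff)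
qed

lemma lie_algebra_pb_lie_algebra:
  assumes D: "subspace D" and pb: "pseudo_bosonic D d a b"
  shows "lie_algebra (pb_lie_algebra smul D d a b)"
proof -
  let ?G = "(\<lambda>j. op_app (a j)) ` {1..d} \<union> (\<lambda>j. op_app (b j)) ` {1..d}"
  have G: "f ` D \<subseteq> D" "\<And>x y. \<lbrakk>x \<in> D; y \<in> D\<rbrakk> \<Longrightarrow> f (x + y) = f x + f y"
    "\<And>x c. x \<in> D \<Longrightarrow> f (smul c x) = smul c (f x)" if "f \<in> ?G" for f
  proof -
    have ops: "densely_defined (a j) \<and> preserves D (a j)"
      "densely_defined (b j) \<and> preserves D (b j)" if "j \<in> {1..d}" for j
      using pb that unfolding pseudo_bosonic_def by meson+
    have "\<exists>A. f = op_app A \<and> densely_defined A \<and> preserves D A"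
      using \<open>f \<in> ?G\<close>
    proof
      assume "f \<in> (\<lambda>j. op_app (a j)) ` {1..d}"
      then show ?thesis using ops(1) by (metis imageE)
    next
      assume "f \<in> (\<lambda>j. op_app (b j)) ` {1..d}"
      then show ?thesis using ops(2) by (metis imageE)
    qed
    then obtain A where "f = op_app A" "densely_defined A" "preserves D A" by metis
    then show "f ` D \<subseteq> D" "\<And>x y. \<lbrakk>x \<in> D; y \<in> D\<rbrakk> \<Longrightarrow> f (x + y) = f x + f y"
      "\<And>x c. x \<in> D \<Longrightarrow> f (smul c x) = smul c (f x)"
      unfolding preserves_def densely_defined_def by (simp_all add: subset_iff)
  qed
  have lin: "f ` D \<subseteq> D \<and> (\<forall>x\<in>D. \<forall>y\<in>D. f (x + y) = f x + f y) \<and>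
    (\<forall>c. \<forall>x\<in>D. f (smul c x) = smul c (f x)) \<and> (\<forall>x. x \<notin> D \<longrightarrow> f x = 0)"
    if "f \<in> op_algebra smul D ?G" for f
    by (rule op_algebra_linear[OF D _ _ _ that]) (erule G; assumption)+
  have into: "f x \<in> D" if "f \<in> op_algebra smul D ?G" for f x
    using lin[OF that] D by (cases "x \<in> D") (auto simp: subspace_def)
  have add: "f (x + y) = f x + f y"
    if "f \<in> op_algebra smul D ?G" "x \<in> D" "y \<in> D" for f x y
    using lin[OF that(1)] that by blast
  have smult: "f (smul c x) = smul c (f x)" if "f \<in> op_algebra smul D ?G" "x \<in> D" for f x c
    using lin[OF that(1)] that by blast
  have diff: "f (x - y) = f x - f y"
    if "f \<in> op_algebra smul D ?G" "x \<in> D" "y \<in> D" for f x y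
  proof -
    have "x - y \<in> D" using D that by (simp add: subspace_diff)
    from add[OF that(1) this that(3)] show ?thesis by simp
  qed
  have op_diff: "f - g \<in> op_algebra smul D ?G"
    if "f \<in> op_algebra smul D ?G" "g \<in> op_algebra smul D ?G" for f g
  proof -
    have "f - g = f + (\<lambda>x. smul (-1) (g x))"
      by (simp add: fun_eq_iff)
    then show ?thesis
      using op_algebra.add[OF that(1) op_algebra.smult[OF that(2), of "-1"]] by (simp only:)
  qed
  have zero: "0 \<in> op_algebra smul D ?G"
    using op_diff[OF op_algebra.one op_algebra.one] by simp
  interpret L: vector_space "scal (pb_lie_algebra smul D d a b)"
    by unfold_locales (auto simp: pb_lie_algebra_def fun_eq_iff scale_right_distrib
        scale_left_distrib)
  show ?thesis
  proof
    show "L.subspace (carr (pb_lie_algebra smul D d a b))"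
      unfolding L.subspace_def
      by (auto simp: pb_lie_algebra_def zero simp del: One_nat_def intro: op_algebra.add op_algebra.smult)
  qed (simp_all del: One_nat_def add: pb_lie_algebra_def op_diff op_algebra.comp fun_eq_iff add smult into diff
        scale_right_diff_distrib)
qed

end

text \<open>HOL cannot quantify over types, so the Hilbert space ranges over all subspaces \<open>H\<close> of
  \<open>nat \<Rightarrow> complex\<close>, with any complete inner product on \<open>H\<close>, not necessarily related to
  the sequence space. Up to isomorphism these are all the Hilbert spaces with at most continuum
  many elements, in particular all separable ones.\<close>

definition pb_realized :: "'a::ab_group_add lie_alg \<Rightarrow> bool" where
  "pb_realized L \<longleftrightarrow>
     (\<exists>(smul :: complex \<Rightarrow> (nat \<Rightarrow> complex) \<Rightarrow> (nat \<Rightarrow> complex)) H ip D d a b S.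
        complex_hilbert_space smul H ip \<and>
        module.subspace smul D \<and> complex_inner_product_space.dense_in_H H ip D \<and>
        1 \<le> d \<and> complex_hilbert_space.pseudo_bosonic smul H ip D d a b \<and>
        lie_subalgebra S (pb_lie_algebra smul D d a b) \<and>
        lie_isomorphic L ((pb_lie_algebra smul D d a b)\<lparr>carr := S\<rparr>))"

end

theory Submission
  imports Defs "HOL-Computational_Algebra.Primes"
begin

text \<open>The Hilbert space is \<open>\<ell>\<^sup>2\<close> and the dense subspace consists of the finitely supported
  sequences. Identifying the index \<open>n\<close> with the positive integer \<open>n + 1\<close>, every prime \<open>p\<close> gives a
  mode: \<open>b e\<^sub>m = e\<^sub>p\<^sub>m\<close>, and \<open>a e\<^sub>m = v e\<^sub>m\<^sub>/\<^sub>p\<close> with \<open>v\<close> the multiplicity of \<open>p\<close> in \<open>m\<close>.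
  Not being normalised, these operators avoid square roots and are pseudo-bosonic but not bosonic.
  The nonabelian indecomposable algebras are represented by words in the modes 2 and 3. Powers of
  the annihilation operator of mode 5 commute with these words and are independent of them; they
  provide the abelian summands. Abelian algebras are spanned by powers of one annihilation operator.\<close>

section \<open>The Hilbert space of square summable sequences\<close>

definition seq_scale :: "complex \<Rightarrow> (nat \<Rightarrow> complex) \<Rightarrow> nat \<Rightarrow> complex" where
  "seq_scale c x = (\<lambda>n. c * x n)"

definition ell2 :: "(nat \<Rightarrow> complex) set" where
  "ell2 = {x. summable (\<lambda>n. (cmod (x n))\<^sup>2)}"

definition ell2_ip :: "(nat \<Rightarrow> complex) \<Rightarrow> (nat \<Rightarrow> complex) \<Rightarrow> complex" where
  "ell2_ip x y = (\<Sum>n. cnj (x n) * y n)"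

definition fin_seqs :: "(nat \<Rightarrow> complex) set" where
  "fin_seqs = {x. finite {n. x n \<noteq> 0}}"

definition unit_seq :: "nat \<Rightarrow> nat \<Rightarrow> complex" where
  "unit_seq n = (\<lambda>m. if m = n then 1 else 0)"

lemma vector_space_seq_scale: "vector_space seq_scale"
  by unfold_locales (auto simp: seq_scale_def fun_eq_iff algebra_simps)

interpretation seq: vector_space seq_scale
  by (rule vector_space_seq_scale)

lemma ell2_add: "x + y \<in> ell2" if "x \<in> ell2" "y \<in> ell2"
proof -
  have "(cmod ((x + y) n))\<^sup>2 \<le> 2 * (cmod (x n))\<^sup>2 + 2 * (cmod (y n))\<^sup>2" for n
  proof -
    have "(cmod ((x + y) n))\<^sup>2 \<le> (cmod (x n) + cmod (y n))\<^sup>2"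
      by (simp add: norm_triangle_ineq)
    also have "\<dots> \<le> 2 * (cmod (x n))\<^sup>2 + 2 * (cmod (y n))\<^sup>2"
      using sum_squares_bound[of "cmod (x n)" "cmod (y n)"] by (simp add: power2_sum)
    finally show ?thesis .
  qed
  moreover have "summable (\<lambda>n. 2 * (cmod (x n))\<^sup>2 + 2 * (cmod (y n))\<^sup>2)"
    using that by (intro summable_add summable_mult) (auto simp: ell2_def)
  ultimately show ?thesis
    unfolding ell2_def by (auto intro: summable_comparison_test')
qed

lemma ell2_scale: "seq_scale c x \<in> ell2" if "x \<in> ell2"
  using that by (auto simp: ell2_def seq_scale_def norm_mult power_mult_distrib intro: summable_mult)

lemma subspace_ell2: "seq.subspace ell2"
  by (rule seq.subspaceI) (auto simp: ell2_add ell2_scale, simp add: ell2_def)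

text \<open>Absolute convergence by comparison: a product of two moduli is at most the sum of their
  squares.\<close>

lemma summable_ell2_ip:
  assumes "x \<in> ell2" "y \<in> ell2"
  shows "summable (\<lambda>n. cnj (x n) * y n)"
proof (rule summable_comparison_test')
  show "summable (\<lambda>n. (cmod (x n))\<^sup>2 + (cmod (y n))\<^sup>2)"
    using assms by (intro summable_add) (auto simp: ell2_def)
  show "norm (cnj (x n) * y n) \<le> (cmod (x n))\<^sup>2 + (cmod (y n))\<^sup>2" for n
  proof -
    have "cmod (x n) * cmod (y n) \<le> 2 * cmod (x n) * cmod (y n)" by simp
    also have "\<dots> \<le> (cmod (x n))\<^sup>2 + (cmod (y n))\<^sup>2" by (rule sum_squares_bound)
    finally show ?thesis by (simp add: norm_mult)
  qed
qed

lemma ell2_ip_self: "ell2_ip x x = of_real (\<Sum>n. (cmod (x n))\<^sup>2)" if "x \<in> ell2"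
proof -
  have "cnj (x n) * x n = of_real ((cmod (x n))\<^sup>2)" for n
    by (metis complex_norm_square mult.commute)
  then show ?thesis
    using that by (simp add: ell2_ip_def ell2_def suminf_of_real del: of_real_power)
qed

lemma complex_inner_product_space_ell2: "complex_inner_product_space seq_scale ell2 ell2_ip"
proof
  fix x y z :: "nat \<Rightarrow> complex" and c
  show "seq.subspace ell2" by (rule subspace_ell2)
  assume x: "x \<in> ell2"
  { assume "y \<in> ell2" "z \<in> ell2"
    with x show "ell2_ip x (y + z) = ell2_ip x y + ell2_ip x z"
      by (simp add: ell2_ip_def distrib_left suminf_add summable_ell2_ip) }
  { assume y: "y \<in> ell2"
    have "ell2_ip x (seq_scale c y) = (\<Sum>n. c * (cnj (x n) * y n))"
      by (simp add: ell2_ip_def seq_scale_def mult_ac)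
    then show "ell2_ip x (seq_scale c y) = c * ell2_ip x y"
      using summable_ell2_ip[OF x y] by (simp add: ell2_ip_def suminf_mult)
    have "(\<lambda>n. cnj (x n) * y n) sums ell2_ip x y"
      using summable_ell2_ip[OF x y] by (simp add: ell2_ip_def summable_sums)
    then have "(\<lambda>n. cnj (y n) * x n) sums cnj (ell2_ip x y)"
      by (subst (asm) sums_cnj[symmetric]) (simp add: mult.commute)
    then show "ell2_ip y x = cnj (ell2_ip x y)"
      by (simp add: ell2_ip_def sums_unique[symmetric]) }
  { assume "x \<noteq> 0"
    then obtain n where "x n \<noteq> 0" by (auto simp: fun_eq_iff)
    then show "0 < Re (ell2_ip x x)"
      using x by (auto simp: ell2_ip_self ell2_def intro!: suminf_pos2[of _ n]) }
qed

interpretation ell2: complex_inner_product_space seq_scale ell2 ell2_ip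
  by (rule complex_inner_product_space_ell2)

lemma hnorm_ell2: "ell2.hnorm x = sqrt (\<Sum>n. (cmod (x n))\<^sup>2)" if "x \<in> ell2"
  by (simp add: ell2.hnorm_def ell2_ip_self that)

lemma ell2_diff: "x - y \<in> ell2" if "x \<in> ell2" "y \<in> ell2"
  using seq.subspace_diff[OF subspace_ell2 that] .

section \<open>Coordinate estimates and completeness\<close>

lemma sum_le_hnorm:
  assumes "x \<in> ell2" "finite F"
  shows "(\<Sum>n\<in>F. (cmod (x n))\<^sup>2) \<le> (ell2.hnorm x)\<^sup>2"
  using assms by (simp add: hnorm_ell2 suminf_nonneg ell2_def sum_le_suminf)

lemma cmod_le_hnorm: "cmod (x n) \<le> ell2.hnorm x" if "x \<in> ell2"
proof -
  have "(cmod (x n))\<^sup>2 \<le> (ell2.hnorm x)\<^sup>2"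
    using sum_le_hnorm[OF that, of "{n}"] by simp
  moreover have "0 \<le> ell2.hnorm x"
    using that by (simp add: hnorm_ell2 suminf_nonneg ell2_def)
  ultimately show ?thesis by (rule power2_le_imp_le)
qed

text \<open>Bounded partial sums give membership and the norm bound together; completeness needs
  both, because the difference to a coordinatewise limit is not known to lie in \<open>ell2\<close>
  beforehand.\<close>

lemma hnorm_leI:
  assumes "\<And>N. (\<Sum>n<N. (cmod (x n))\<^sup>2) \<le> e\<^sup>2" "0 \<le> e"
  shows "x \<in> ell2" "ell2.hnorm x \<le> e"
proof -
  have *: "summable (\<lambda>n. (cmod (x n))\<^sup>2)"
    by (rule summableI_nonneg_bounded) (use assms in auto)
  then show x: "x \<in> ell2" by (simp add: ell2_def)
  have "(\<Sum>n. (cmod (x n))\<^sup>2) \<le> e\<^sup>2"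
    using suminf_le_const[OF * assms(1)] .
  then show "ell2.hnorm x \<le> e"
    using assms(2) by (simp add: hnorm_ell2[OF x] real_le_lsqrt suminf_nonneg *)
qed

lemma complex_hilbert_space_ell2: "complex_hilbert_space seq_scale ell2 ell2_ip"
proof
  fix X :: "nat \<Rightarrow> nat \<Rightarrow> complex"
  assume X: "\<And>n. X n \<in> ell2"
    and cauchy: "\<And>e. 0 < e \<Longrightarrow> \<exists>N. \<forall>m\<ge>N. \<forall>n\<ge>N. ell2.hnorm (X m - X n) < e"
  \<comment> \<open>Coordinates are dominated by the norm, so each coordinate sequence is Cauchy and
    the limit \<open>l\<close> can be taken coordinatewise.\<close>
  have "Cauchy (\<lambda>m. X m k)" for k
  proof (rule metric_CauchyI)
    fix e :: real assume "0 < e"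
    then obtain N where N: "\<forall>m\<ge>N. \<forall>n\<ge>N. ell2.hnorm (X m - X n) < e"
      using cauchy by blast
    have "dist (X m k) (X n k) < e" if "m \<ge> N" "n \<ge> N" for m n
    proof -
      have "dist (X m k) (X n k) \<le> ell2.hnorm (X m - X n)"
        using cmod_le_hnorm[OF ell2_diff[OF X X], of m n k] by (simp add: dist_norm)
      also have "\<dots> < e" using N that by blast
      finally show ?thesis .
    qed
    then show "\<exists>M. \<forall>m\<ge>M. \<forall>n\<ge>M. dist (X m k) (X n k) < e" by blast
  qed
  then have "\<exists>l. (\<lambda>m. X m k) \<longlonglongrightarrow> l" for k
    by (simp add: Cauchy_convergent_iff convergent_def)
  then obtain l where l: "\<And>k. (\<lambda>m. X m k) \<longlonglongrightarrow> l k" by metis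
  \<comment> \<open>Only finite partial sums are passed to the limit in \<open>n\<close>, where
    coordinatewise convergence suffices; the bound is uniform in \<open>K\<close> and hence controls
    the whole series.\<close>
  have tail: "\<exists>N. \<forall>m\<ge>N. X m - l \<in> ell2 \<and> ell2.hnorm (X m - l) \<le> e" if e: "0 < e" for e
  proof -
    obtain N where N: "\<forall>m\<ge>N. \<forall>n\<ge>N. ell2.hnorm (X m - X n) < e"
      using cauchy[OF e] by blast
    have "(\<Sum>k<K. (cmod ((X m - l) k))\<^sup>2) \<le> e\<^sup>2" if "m \<ge> N" for m K
    proof (rule tendsto_upperbound)
      show "(\<lambda>n. \<Sum>k<K. (cmod (X m k - X n k))\<^sup>2) \<longlonglongrightarrow> (\<Sum>k<K. (cmod ((X m - l) k))\<^sup>2)"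
        unfolding minus_apply
        by (intro tendsto_sum tendsto_power tendsto_norm tendsto_diff tendsto_const l)
      have "(\<Sum>k<K. (cmod (X m k - X n k))\<^sup>2) \<le> e\<^sup>2" if "n \<ge> N" for n
      proof -
        have "(\<Sum>k<K. (cmod ((X m - X n) k))\<^sup>2) \<le> (ell2.hnorm (X m - X n))\<^sup>2"
          by (intro sum_le_hnorm ell2_diff X) auto
        also have "\<dots> \<le> e\<^sup>2"
        proof (rule power_mono)
          show "ell2.hnorm (X m - X n) \<le> e" using N that \<open>m \<ge> N\<close> by (blast intro: less_imp_le)
          show "0 \<le> ell2.hnorm (X m - X n)"
            using order_trans[OF norm_ge_zero cmod_le_hnorm[OF ell2_diff[OF X X]]] .
        qed
        finally show ?thesis by simp
      qed
      then show "\<forall>\<^sub>F n in sequentially. (\<Sum>k<K. (cmod (X m k - X n k))\<^sup>2) \<le> e\<^sup>2"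
        by (auto simp: eventually_sequentially)
    qed simp
    then have "\<forall>m\<ge>N. X m - l \<in> ell2 \<and> ell2.hnorm (X m - l) \<le> e"
      using e by (intro allI impI conjI hnorm_leI) auto
    then show ?thesis ..
  qed
  obtain N where "X N - l \<in> ell2" using tail[of 1] by auto
  \<comment> \<open>\<open>l\<close> is \<open>X N\<close> minus the square summable difference
    \<open>X N - l\<close>.\<close>
  then have "l \<in> ell2" using ell2_diff[OF X[of N], of "X N - l"] by simp
  moreover have "(\<lambda>n. ell2.hnorm (X n - l)) \<longlonglongrightarrow> 0"
  proof (rule metric_LIMSEQ_I)
    fix r :: real assume r: "0 < r"
    then obtain N where N: "\<forall>m\<ge>N. X m - l \<in> ell2 \<and> ell2.hnorm (X m - l) \<le> r / 2"
      using tail[of "r / 2"] by auto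
    have "dist (ell2.hnorm (X n - l)) 0 < r" if "n \<ge> N" for n
    proof -
      have "0 \<le> ell2.hnorm (X n - l)"
        using order_trans[OF norm_ge_zero cmod_le_hnorm] N that by blast
      moreover have "ell2.hnorm (X n - l) \<le> r / 2" using N that by blast
      ultimately show ?thesis using r by simp
    qed
    then show "\<exists>N. \<forall>n\<ge>N. dist (ell2.hnorm (X n - l)) 0 < r" by blast
  qed
  ultimately show "\<exists>l\<in>ell2. (\<lambda>n. ell2.hnorm (X n - l)) \<longlonglongrightarrow> 0" by blast
qed

interpretation ell2: complex_hilbert_space seq_scale ell2 ell2_ip
  by (rule complex_hilbert_space_ell2)

section \<open>Finitely supported sequences as a common dense domain\<close>

lemma unit_seq_fin_seqs: "unit_seq n \<in> fin_seqs"
  by (simp add: fin_seqs_def unit_seq_def)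

lemma fin_seqs_subset_ell2: "fin_seqs \<subseteq> ell2"
  by (auto simp: fin_seqs_def ell2_def intro!: summable_finite)

lemma subspace_fin_seqs: "seq.subspace fin_seqs"
proof (rule seq.subspaceI)
  fix x y :: "nat \<Rightarrow> complex" and c
  show "0 \<in> fin_seqs" by (simp add: fin_seqs_def)
  assume x: "x \<in> fin_seqs"
  then show "seq_scale c x \<in> fin_seqs"
    by (auto simp: fin_seqs_def seq_scale_def elim: rev_finite_subset)
  assume "y \<in> fin_seqs"
  with x have "finite ({n. x n \<noteq> 0} \<union> {n. y n \<noteq> 0})" by (simp add: fin_seqs_def)
  then show "x + y \<in> fin_seqs"
    unfolding fin_seqs_def mem_Collect_eq by (rule rev_finite_subset) auto
qed

lemma dense_fin_seqs: "ell2.dense_in_H fin_seqs"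
  unfolding ell2.dense_in_H_def
proof (intro conjI ballI allI impI fin_seqs_subset_ell2)
  fix x :: "nat \<Rightarrow> complex" and e :: real
  assume x: "x \<in> ell2" and e: "0 < e"
  have sm: "summable (\<lambda>n. (cmod (x n))\<^sup>2)" using x by (simp add: ell2_def)
  obtain N where N: "\<And>n. n \<ge> N \<Longrightarrow> norm (\<Sum>i. (cmod (x (i + n)))\<^sup>2) < (e / 2)\<^sup>2"
    using suminf_exist_split[OF _ sm, of "(e / 2)\<^sup>2"] e by auto
  \<comment> \<open>Truncation at \<open>N\<close>: the squared norm of \<open>x - y\<close> is a
    tail of the convergent series of \<open>x\<close>.\<close>
  define y where "y = (\<lambda>n. if n < N then x n else 0)"
  have y: "y \<in> fin_seqs" by (auto simp: fin_seqs_def y_def)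
  have sN: "summable (\<lambda>i. (cmod (x (i + N)))\<^sup>2)"
    using summable_iff_shift[of "\<lambda>n. (cmod (x n))\<^sup>2" N] sm by blast
  have "(\<Sum>n<K. (cmod ((x - y) n))\<^sup>2) \<le> (e / 2)\<^sup>2" for K
  proof -
    \<comment> \<open>Enlarging the range to \<open>N + K\<close> avoids a case split on whether
      \<open>K\<close> exceeds \<open>N\<close>.\<close>
    have "(\<Sum>n<K. (cmod ((x - y) n))\<^sup>2) \<le> (\<Sum>n<N + K. (cmod ((x - y) n))\<^sup>2)"
      by (rule sum_mono2) auto
    also have "\<dots> = (\<Sum>n\<in>{N..<N + K}. (cmod ((x - y) n))\<^sup>2)"
      by (rule sum.mono_neutral_right) (auto simp: y_def)
    also have "\<dots> = (\<Sum>i<K. (cmod (x (i + N)))\<^sup>2)"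
      by (rule sum.reindex_bij_witness[of _ "\<lambda>i. i + N" "\<lambda>i. i - N"]) (auto simp: y_def)
    also have "\<dots> \<le> (\<Sum>i. (cmod (x (i + N)))\<^sup>2)"
      by (rule sum_le_suminf[OF sN]) auto
    also have "\<dots> \<le> (e / 2)\<^sup>2" using N[of N] by simp
    finally show ?thesis .
  qed
  then have "ell2.hnorm (x - y) \<le> e / 2"
    by (rule hnorm_leI) (use e in simp)
  with e y show "\<exists>y\<in>fin_seqs. ell2.hnorm (x - y) < e"
    by (intro bexI[of _ y]) auto
qed

lemma ell2_ip_unit_seq: "ell2_ip z (unit_seq n) = cnj (z n)"
proof -
  have "ell2_ip z (unit_seq n) = (\<Sum>m\<in>{n}. cnj (z m) * unit_seq n m)"
    unfolding ell2_ip_def by (rule suminf_finite) (auto simp: unit_seq_def)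
  then show ?thesis by (simp add: unit_seq_def)
qed

text \<open>On the dense domain it is enough to exhibit a formal adjoint \<open>f\<close>: pairing
  with unit vectors determines every coordinate, so the \<open>THE\<close> in
  \<open>adjoint_op\<close> evaluates to \<open>f y\<close>.\<close>

lemma preserves_adjointI:
  assumes dom: "op_dom A = fin_seqs" and f: "f ` fin_seqs \<subseteq> fin_seqs"
    and adj: "\<And>x y. \<lbrakk>x \<in> fin_seqs; y \<in> fin_seqs\<rbrakk> \<Longrightarrow> ell2_ip y (op_app A x) = ell2_ip (f y) x"
  shows "ell2.preserves fin_seqs (ell2.adjoint_op A)"
proof -
  have "y \<in> op_dom (ell2.adjoint_op A) \<and> op_app (ell2.adjoint_op A) y = f y"
    if y: "y \<in> fin_seqs" for y
  proof
    have fy: "f y \<in> ell2" using f y fin_seqs_subset_ell2 by blast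
    show "y \<in> op_dom (ell2.adjoint_op A)"
      using y fin_seqs_subset_ell2 fy adj by (auto simp: ell2.adjoint_op_def dom)
    have "z = f y" if "\<forall>x\<in>fin_seqs. ell2_ip y (op_app A x) = ell2_ip z x" for z
    proof
      fix n
      have "cnj (z n) = cnj (f y n)"
        using that adj[OF _ y] unit_seq_fin_seqs[of n] by (metis ell2_ip_unit_seq)
      then show "z n = f y n" by simp
    qed
    then show "op_app (ell2.adjoint_op A) y = f y"
      using fy adj[OF _ y] unfolding ell2.adjoint_op_def dom
      by (auto intro!: the_equality)
  qed
  with f show ?thesis unfolding ell2.preserves_def by auto
qed

section \<open>Modes indexed by primes\<close>

interpretation seq_pair: vector_space_pair seq_scale seq_scale
  by unfold_locales

abbreviation seq_linear :: "((nat \<Rightarrow> complex) \<Rightarrow> nat \<Rightarrow> complex) \<Rightarrow> bool" where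
  "seq_linear \<equiv> Vector_Spaces.linear seq_scale seq_scale"

lemma seq_linearI:
  assumes "\<And>u v. f (u + v) = f u + f v" "\<And>c u. f (seq_scale c u) = seq_scale c (f u)"
  shows "seq_linear f"
  using assms by unfold_locales (auto simp: seq_scale_def fun_eq_iff algebra_simps)

text \<open>Coordinate \<open>n\<close> stands for the integer \<open>n + 1\<close>, so
  \<open>p * Suc n - 1\<close> is the position of \<open>p\<close> times that integer. The weight
  \<open>w n\<close> belongs to the smaller integer in both directions, which makes
  \<open>lowering p w\<close> and \<open>raising p w\<close> transposes of each other for positive
  \<open>p\<close>.\<close>

definition lowering :: "nat \<Rightarrow> (nat \<Rightarrow> nat) \<Rightarrow> (nat \<Rightarrow> complex) \<Rightarrow> nat \<Rightarrow> complex" where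
  "lowering p w u = (\<lambda>n. of_nat (w n) * u (p * Suc n - 1))"

definition raising :: "nat \<Rightarrow> (nat \<Rightarrow> nat) \<Rightarrow> (nat \<Rightarrow> complex) \<Rightarrow> nat \<Rightarrow> complex" where
  "raising p w u = (\<lambda>n. if p dvd Suc n
     then of_nat (w (Suc n div p - 1)) * u (Suc n div p - 1) else 0)"

text \<open>For prime \<open>p\<close> the weight is the multiplicity of \<open>p\<close> in
  \<open>p * Suc n\<close>, the integer from which the basis vector is lowered.\<close>

definition ann :: "nat \<Rightarrow> (nat \<Rightarrow> complex) \<Rightarrow> nat \<Rightarrow> complex" where
  "ann p = lowering p (\<lambda>n. Suc (multiplicity p (Suc n)))"

definition cre :: "nat \<Rightarrow> (nat \<Rightarrow> complex) \<Rightarrow> nat \<Rightarrow> complex" where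
  "cre p = raising p (\<lambda>_. 1)"

lemma ann_apply: "ann p u n = of_nat (Suc (multiplicity p (Suc n))) * u (p * Suc n - 1)"
  by (simp add: ann_def lowering_def)

lemma cre_apply: "cre p u n = (if p dvd Suc n then u (Suc n div p - 1) else 0)"
  by (simp add: cre_def raising_def)

lemma seq_linear_lowering: "seq_linear (lowering p w)"
  by (rule seq_linearI) (auto simp: lowering_def seq_scale_def fun_eq_iff algebra_simps)

lemma seq_linear_raising: "seq_linear (raising p w)"
  by (rule seq_linearI) (auto simp: raising_def seq_scale_def fun_eq_iff algebra_simps)

lemmas seq_linear_ann = seq_linear_lowering[of p "\<lambda>n. Suc (multiplicity p (Suc n))" for p,
    folded ann_def]
lemmas seq_linear_cre = seq_linear_raising[of p "\<lambda>_. 1" for p, folded cre_def]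

lemma inj_mult_Suc: "p > 0 \<Longrightarrow> inj (\<lambda>n. p * Suc n - 1)" for p :: nat
proof (rule injI)
  fix m n assume "p > 0" and eq: "p * Suc m - 1 = p * Suc n - 1"
  then have "0 < p * Suc m" "0 < p * Suc n" by auto
  with eq have "p * Suc m = p * Suc n" by linarith
  with \<open>p > 0\<close> show "m = n" by simp
qed

section \<open>Invariance of the domain and adjoints of the shifts\<close>

lemma lowering_fin_seqs:
  assumes "p > 0" shows "lowering p w ` fin_seqs \<subseteq> fin_seqs"
proof clarify
  fix u assume "u \<in> fin_seqs"
  \<comment> \<open>The support of the image lies in the preimage of the support of \<open>u\<close>
    under an injective index map.\<close>
  then have "finite ((\<lambda>n. p * Suc n - 1) -` {n. u n \<noteq> 0})"
    using finite_vimageI[OF _ inj_mult_Suc[OF assms]] unfolding fin_seqs_def by blast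
  then show "lowering p w u \<in> fin_seqs"
    unfolding fin_seqs_def mem_Collect_eq by (rule rev_finite_subset) (auto simp: lowering_def)
qed

lemma raising_fin_seqs:
  assumes "p > 0" shows "raising p w ` fin_seqs \<subseteq> fin_seqs"
proof clarify
  fix u assume "u \<in> fin_seqs"
  then have "finite ((\<lambda>n. p * Suc n - 1) ` {n. u n \<noteq> 0})"
    by (simp add: fin_seqs_def)
  moreover have "{n. raising p w u n \<noteq> 0} \<subseteq> (\<lambda>n. p * Suc n - 1) ` {n. u n \<noteq> 0}"
  proof
    fix m assume "m \<in> {n. raising p w u n \<noteq> 0}"
    then have "p dvd Suc m" and u: "u (Suc m div p - 1) \<noteq> 0"
      by (auto simp: raising_def split: if_splits)
    then obtain k where k: "Suc m = p * k" by blast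
    then have "k > 0" by (cases k) auto
    with k assms u show "m \<in> (\<lambda>n. p * Suc n - 1) ` {n. u n \<noteq> 0}"
      by (intro image_eqI[of _ _ "k - 1"]) auto
  qed
  ultimately show "raising p w u \<in> fin_seqs"
    unfolding fin_seqs_def mem_Collect_eq by (rule rev_finite_subset)
qed

text \<open>Both pairings reduce to one finite sum, reindexed along \<open>s\<close>:
  \<open>raising\<close> vanishes off the range of \<open>s\<close>, and the weights are natural
  numbers, so conjugation fixes them.\<close>

lemma ell2_ip_lowering:
  assumes p: "p > 0" and x: "x \<in> fin_seqs"
  shows "ell2_ip y (lowering p w x) = ell2_ip (raising p w y) x"
proof -
  define s where "s = (\<lambda>n. p * Suc n - 1)"
  have inj: "inj s" unfolding s_def by (rule inj_mult_Suc[OF p])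
  define K where "K = s -` {n. x n \<noteq> 0}"
  have fin: "finite K"
    using x finite_vimageI[OF _ inj] unfolding K_def fin_seqs_def by blast
  have rs: "raising p w y (s n) = of_nat (w n) * y n" for n
  proof -
    have "Suc (s n) = p * Suc n" using p by (simp add: s_def)
    then show ?thesis using p by (simp add: raising_def del: mult_Suc_right)
  qed
  have r0: "raising p w y m = 0" if "m \<notin> range s" for m
  proof (rule ccontr)
    assume "raising p w y m \<noteq> 0"
    then obtain k where k: "Suc m = p * k" by (auto simp: raising_def split: if_splits)
    then have "k > 0" by (cases k) auto
    with k have "m = s (k - 1)" by (simp add: s_def del: mult_Suc_right)
    with that show False by blast
  qed
  have "ell2_ip y (lowering p w x) = (\<Sum>n\<in>K. cnj (y n) * (of_nat (w n) * x (s n)))"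
    unfolding ell2_ip_def lowering_def s_def[symmetric]
    using suminf_finite[OF fin, of "\<lambda>n. cnj (y n) * (of_nat (w n) * x (s n))"]
    by (auto simp: K_def s_def)
  also have "\<dots> = (\<Sum>n\<in>K. cnj (raising p w y (s n)) * x (s n))"
    by (simp add: rs mult_ac)
  also have "\<dots> = (\<Sum>m\<in>s ` K. cnj (raising p w y m) * x m)"
    using inj by (subst sum.reindex) (auto simp: inj_on_def)
  also have "\<dots> = ell2_ip (raising p w y) x"
    unfolding ell2_ip_def
  proof (rule suminf_finite[symmetric])
    show "cnj (raising p w y m) * x m = 0" if "m \<notin> s ` K" for m
    proof (cases "m \<in> range s")
      case True
      with that show ?thesis by (auto simp: K_def)
    qed (simp add: r0)
  qed (use fin in simp)
  finally show ?thesis .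
qed

text \<open>Conjugate symmetry reduces this to the previous identity; finite support of both vectors
  puts every vector involved into \<open>ell2\<close>.\<close>

lemma ell2_ip_raising:
  assumes "p > 0" "x \<in> fin_seqs" "y \<in> fin_seqs"
  shows "ell2_ip y (raising p w x) = ell2_ip (lowering p w y) x"
proof -
  have "ell2_ip y (raising p w x) = cnj (ell2_ip (raising p w x) y)"
    using assms raising_fin_seqs[of p w] fin_seqs_subset_ell2 by (intro ell2.ip_commute) auto
  also have "\<dots> = cnj (ell2_ip x (lowering p w y))"
    using assms by (simp add: ell2_ip_lowering)
  also have "\<dots> = ell2_ip (lowering p w y) x"
    using assms lowering_fin_seqs[of p w] fin_seqs_subset_ell2
    by (intro ell2.ip_commute[symmetric]) auto
  finally show ?thesis .
qed

section \<open>Commutation relations of the modes\<close>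

lemma ann_cre_same:
  assumes "prime p" shows "ann p (cre p u) = cre p (ann p u) + u"
proof
  fix n
  have p: "p > 0" "p > 1" using prime_gt_1_nat[OF assms] by auto
  have 1: "Suc (p * Suc n - 1) = p * Suc n" using p by simp
  \<comment> \<open>With \<open>v\<close> the multiplicity of \<open>p\<close> in
    \<open>Suc n\<close>, creating and then annihilating multiplies by \<open>v + 1\<close>, the
    opposite order by \<open>v\<close>; the difference is the identity.\<close>
  have "ann p (cre p u) n = of_nat (Suc (multiplicity p (Suc n))) * u n"
    unfolding ann_apply cre_apply 1 using p by (simp del: mult_Suc_right)
  moreover have "cre p (ann p u) n = of_nat (multiplicity p (Suc n)) * u n"
  proof (cases "p dvd Suc n")
    case True
    then obtain k where k: "Suc n = p * k" by blast
    then have k0: "k > 0" by (cases k) auto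
    then have "multiplicity p (p * k) = Suc (multiplicity p k)"
      using p by (intro multiplicity_times_same) auto
    moreover have "p * k - 1 = n" using k by simp
    ultimately show ?thesis
      unfolding ann_apply cre_apply k using k0 p by (simp del: mult_Suc_right)
  qed (simp add: cre_apply not_dvd_imp_multiplicity_0)
  ultimately show "ann p (cre p u) n = (cre p (ann p u) + u) n"
    by (simp add: algebra_simps)
qed

text \<open>A factor \<open>q\<close> leaves the multiplicity of \<open>p\<close> unchanged, and a
  factor \<open>p\<close> does not affect divisibility by \<open>q\<close>.\<close>

lemma ann_cre_distinct:
  assumes "prime p" "prime q" "p \<noteq> q" shows "ann p (cre q u) = cre q (ann p u)"
proof
  fix n
  have p: "p > 0" "q > 0" "q > 1" using assms prime_gt_1_nat[of q] by (auto simp: prime_gt_0_nat)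
  have cop: "coprime q p" using assms by (simp add: primes_coprime)
  have 1: "Suc (p * Suc n - 1) = p * Suc n" using p by simp
  show "ann p (cre q u) n = cre q (ann p u) n"
  proof (cases "q dvd Suc n")
    case True
    then obtain k where k: "Suc n = q * k" by blast
    then have k0: "k > 0" by (cases k) auto
    have "multiplicity p q = 0" using assms by (rule prime_multiplicity_other)
    then have "multiplicity p (q * k) = multiplicity p k"
      using p k0 assms by (subst prime_elem_multiplicity_mult_distrib) auto
    moreover have "p * (q * k) div q = p * k" using p by simp
    ultimately show ?thesis
      unfolding ann_apply cre_apply 1 k using k0 p by (simp del: mult_Suc_right)
  next
    case False
    then have "\<not> q dvd p * Suc n" using cop by (simp add: coprime_dvd_mult_right_iff del: mult_Suc_right)
    with False show ?thesis unfolding ann_apply cre_apply 1 by simp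
  qed
qed

lemma ann_ann_distinct:
  assumes "prime p" "prime q" "p \<noteq> q" shows "ann p (ann q u) = ann q (ann p u)"
proof
  fix n
  have p: "p > 0" "q > 0" using assms by (auto simp: prime_gt_0_nat)
  have 1: "Suc (p * Suc n - 1) = p * Suc n" "Suc (q * Suc n - 1) = q * Suc n" using p by auto
  have "multiplicity q (p * Suc n) = multiplicity q (Suc n)"
    "multiplicity p (q * Suc n) = multiplicity p (Suc n)"
    using assms p by (auto simp: prime_elem_multiplicity_mult_distrib prime_multiplicity_other
        simp del: mult_Suc_right)
  then show "ann p (ann q u) n = ann q (ann p u) n"
    unfolding ann_apply 1 by (simp add: mult_ac del: mult_Suc_right)
qed

text \<open>Either order reads the coordinate of \<open>Suc n\<close> divided by
  \<open>p * q\<close>, which is symmetric in the two primes.\<close>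

lemma cre_cre_commute:
  assumes "prime p" "prime q" shows "cre p (cre q u) = cre q (cre p u)"
proof -
  have "cre p (cre q u) n = (if p * q dvd Suc n then u (Suc n div (p * q) - 1) else 0)"
    if "prime p" "prime q" for p q n
  proof (cases "p dvd Suc n")
    case True
    then obtain k where k: "Suc n = p * k" by blast
    then have "k > 0" by (cases k) auto
    moreover have "p > 0" using that by (simp add: prime_gt_0_nat)
    ultimately show ?thesis unfolding cre_apply k by simp
  next
    case False
    then have "\<not> p * q dvd Suc n" by (metis dvd_mult_left)
    with False show ?thesis by (simp add: cre_apply)
  qed
  from this[OF assms] this[OF assms(2,1)] show ?thesis
    by (simp add: fun_eq_iff mult.commute)
qed

section \<open>Representations in the Weyl algebra\<close>

definition modes :: "nat set" where "modes = {2, 3, 5}"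

lemma prime_modes: "p \<in> modes \<Longrightarrow> prime p"
  by (auto simp: modes_def)

text \<open>Members are linear maps on all sequences, so they compose and can be compared at every
  sequence; only their restrictions to \<open>fin_seqs\<close> have to lie in the generated operator
  algebra.\<close>

definition weyl :: "((nat \<Rightarrow> complex) \<Rightarrow> nat \<Rightarrow> complex) set" where
  "weyl = {f. seq_linear f \<and> f ` fin_seqs \<subseteq> fin_seqs \<and>
     restrict_op fin_seqs f \<in> op_algebra seq_scale fin_seqs (ann ` modes \<union> cre ` modes)}"

lemma weyl_linear: "f \<in> weyl \<Longrightarrow> seq_linear f"
  and weyl_closed: "\<lbrakk>f \<in> weyl; u \<in> fin_seqs\<rbrakk> \<Longrightarrow> f u \<in> fin_seqs"
  by (auto simp: weyl_def)

lemma weyl_id: "id \<in> weyl" "(\<lambda>u. u) \<in> weyl"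
proof -
  show "id \<in> weyl"
    by (auto simp: weyl_def op_algebra.one seq.linear_id)
  then show "(\<lambda>u. u) \<in> weyl" by (simp add: id_def)
qed

lemma weyl_ann: "p \<in> modes \<Longrightarrow> ann p \<in> weyl"
  using lowering_fin_seqs[of p] prime_gt_0_nat[OF prime_modes[of p]]
  by (simp add: weyl_def seq_linear_ann op_algebra.gen) (simp add: ann_def)

lemma weyl_cre: "p \<in> modes \<Longrightarrow> cre p \<in> weyl"
  using raising_fin_seqs[of p] prime_gt_0_nat[OF prime_modes[of p]]
  by (simp add: weyl_def seq_linear_cre op_algebra.gen) (simp add: cre_def)

lemma weyl_add:
  assumes "f \<in> weyl" "g \<in> weyl" shows "(\<lambda>u. f u + g u) \<in> weyl"
proof -
  have "restrict_op fin_seqs (\<lambda>u. f u + g u) = restrict_op fin_seqs f + restrict_op fin_seqs g"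
    by (auto simp: restrict_op_def fun_eq_iff)
  with assms show ?thesis
    unfolding weyl_def
    by (auto intro!: op_algebra.add seq_pair.linear_compose_add seq.subspace_add[OF subspace_fin_seqs])
qed

lemma weyl_scale:
  assumes "f \<in> weyl" shows "(\<lambda>u. seq_scale c (f u)) \<in> weyl"
proof -
  have "restrict_op fin_seqs (\<lambda>u. seq_scale c (f u)) = (\<lambda>u. seq_scale c (restrict_op fin_seqs f u))"
    by (auto simp: restrict_op_def fun_eq_iff)
  with assms show ?thesis
    unfolding weyl_def
    by (auto intro!: op_algebra.smult seq_pair.linear_compose_scale_right
        seq.subspace_scale[OF subspace_fin_seqs])
qed

text \<open>Off \<open>D\<close> the inner restriction returns 0, so the sides agree there because
  \<open>f 0 = 0\<close>; on \<open>D\<close> the values of \<open>g\<close> stay in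
  \<open>D\<close>.\<close>

lemma restrict_op_comp:
  "g ` D \<subseteq> D \<Longrightarrow> f 0 = 0 \<Longrightarrow> restrict_op D (f \<circ> g) = restrict_op D f \<circ> restrict_op D g"
  by (auto simp: restrict_op_def fun_eq_iff)

lemma weyl_comp:
  assumes "f \<in> weyl" "g \<in> weyl" shows "(\<lambda>u. f (g u)) \<in> weyl"
proof -
  have "f 0 = 0" using seq_pair.linear_0[OF weyl_linear[OF assms(1)]] .
  then have "restrict_op fin_seqs (f \<circ> g) = restrict_op fin_seqs f \<circ> restrict_op fin_seqs g"
    using assms by (intro restrict_op_comp) (auto simp: weyl_def)
  moreover have "seq_linear (f \<circ> g)"
    using weyl_linear[OF assms(1)] weyl_linear[OF assms(2)]
    by (intro seq_linearI) (simp_all only: comp_apply seq_pair.linear_add seq_pair.linear_scale)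
  ultimately have "f \<circ> g \<in> weyl"
    using assms unfolding weyl_def by (auto intro!: op_algebra.comp)
  then show ?thesis by (simp add: comp_def)
qed

lemma weyl_zero: "(\<lambda>u. 0) \<in> weyl"
  using weyl_scale[OF weyl_id(2), of 0] by simp

lemma weyl_sum:
  assumes "\<And>i. i \<in> I \<Longrightarrow> f i \<in> weyl" shows "(\<lambda>u. \<Sum>i\<in>I. f i u) \<in> weyl"
  using assms by (induction I rule: infinite_finite_induct) (auto intro: weyl_zero weyl_add)

lemma weyl_funpow: "f \<in> weyl \<Longrightarrow> f ^^ k \<in> weyl"
  by (induction k) (auto simp: weyl_id weyl_comp comp_def)

section \<open>Three modes as a pseudo-bosonic family\<close>

definition mode_prime :: "nat \<Rightarrow> nat" where
  "mode_prime j = (if j = 1 then 2 else if j = 2 then 3 else 5)"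

lemma mode_prime: "mode_prime ` {1..3} = modes" "inj_on mode_prime {1..3}"
  by (auto simp: mode_prime_def modes_def inj_on_def numeral_3_eq_3 atLeastAtMostSuc_conv)

definition fin_op :: "((nat \<Rightarrow> complex) \<Rightarrow> nat \<Rightarrow> complex) \<Rightarrow> (nat \<Rightarrow> complex) unbounded_op" where
  "fin_op f = \<lparr>op_dom = fin_seqs, op_app = f\<rparr>"

lemma densely_defined_fin_op:
  assumes "f \<in> weyl" shows "ell2.densely_defined (fin_op f)"
  using weyl_linear[OF assms] weyl_closed[OF assms] fin_seqs_subset_ell2
  by (auto simp: ell2.densely_defined_def fin_op_def subspace_fin_seqs dense_fin_seqs
      seq_pair.linear_add seq_pair.linear_scale)

lemma pseudo_bosonic_modes:
  "ell2.pseudo_bosonic fin_seqs 3 (\<lambda>j. fin_op (ann (mode_prime j))) (\<lambda>j. fin_op (cre (mode_prime j)))"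
  unfolding ell2.pseudo_bosonic_def
proof (intro conjI ballI)
  fix j k assume j: "j \<in> {1..3::nat}" and k: "k \<in> {1..3::nat}"
  let ?p = "mode_prime j" and ?q = "mode_prime k"
  have p: "?p \<in> modes" "?p > 0" and q: "?q \<in> modes"
    using j k mode_prime(1) prime_gt_0_nat[OF prime_modes, of ?p] by blast+
  note pr = prime_modes[OF p(1)] prime_modes[OF q]
  have jk: "?p = ?q \<longleftrightarrow> j = k" using j k mode_prime(2) by (simp add: inj_on_eq_iff)
  show "ell2.densely_defined (fin_op (ann ?p))" "ell2.densely_defined (fin_op (cre ?p))"
    by (intro densely_defined_fin_op weyl_ann weyl_cre p)+
  show "ell2.preserves fin_seqs (fin_op (ann ?p))" "ell2.preserves fin_seqs (fin_op (cre ?p))"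
    using weyl_closed[OF weyl_ann[OF p(1)]] weyl_closed[OF weyl_cre[OF p(1)]]
    by (auto simp: ell2.preserves_def fin_op_def)
  \<comment> \<open>The witness for the adjoint of \<open>ann ?p\<close> is the raising operator
    with the same multiplicity weights; for \<open>cre ?p\<close> it is the lowering operator with
    weight one.\<close>
  show "ell2.preserves fin_seqs (ell2.adjoint_op (fin_op (ann ?p)))"
    using raising_fin_seqs[OF p(2)]
    by (rule preserves_adjointI[rotated]) (auto simp: fin_op_def ann_def ell2_ip_lowering p)
  show "ell2.preserves fin_seqs (ell2.adjoint_op (fin_op (cre ?p)))"
    using lowering_fin_seqs[OF p(2)]
    by (rule preserves_adjointI[rotated]) (auto simp: fin_op_def cre_def ell2_ip_raising p)
  show "ell2.commutes_to fin_seqs (fin_op (ann ?p)) (fin_op (cre ?q)) (if j = k then 1 else 0)"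
    using ann_cre_same[OF pr(1)] ann_cre_distinct[OF pr] jk
    by (auto simp: ell2.commutes_to_def fin_op_def seq_scale_def fun_eq_iff)
  show "ell2.commutes_to fin_seqs (fin_op (ann ?p)) (fin_op (ann ?q)) 0"
    using ann_ann_distinct[OF pr] jk
    by (cases "j = k") (auto simp: ell2.commutes_to_def fin_op_def)
  show "ell2.commutes_to fin_seqs (fin_op (cre ?p)) (fin_op (cre ?q)) 0"
    using cre_cre_commute[OF pr]
    by (auto simp: ell2.commutes_to_def fin_op_def)
qed

section \<open>Faithful representations and realizability\<close>

definition weyl_rep :: "'a::ab_group_add lie_alg \<Rightarrow> ('a \<Rightarrow> (nat \<Rightarrow> complex) \<Rightarrow> nat \<Rightarrow> complex) \<Rightarrow> bool"
  where "weyl_rep L \<phi> \<longleftrightarrow> (\<forall>x\<in>carr L. \<phi> x \<in> weyl) \<and>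
    (\<forall>x\<in>carr L. \<forall>y\<in>carr L. \<forall>u. \<phi> (x + y) u = \<phi> x u + \<phi> y u) \<and>
    (\<forall>c. \<forall>x\<in>carr L. \<forall>u. \<phi> (scal L c x) u = seq_scale c (\<phi> x u)) \<and>
    (\<forall>x\<in>carr L. \<forall>y\<in>carr L. \<forall>u. \<phi> (brk L x y) u = \<phi> x (\<phi> y u) - \<phi> y (\<phi> x u)) \<and>
    (\<forall>x\<in>carr L. (\<forall>u\<in>fin_seqs. \<phi> x u = 0) \<longrightarrow> x = 0)"

lemma weyl_repD:
  assumes "weyl_rep L \<phi>" "x \<in> carr L"
  shows "\<phi> x \<in> weyl"
    and "y \<in> carr L \<Longrightarrow> \<phi> (x + y) u = \<phi> x u + \<phi> y u"
    and "\<phi> (scal L c x) u = seq_scale c (\<phi> x u)"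
    and "y \<in> carr L \<Longrightarrow> \<phi> (brk L x y) u = \<phi> x (\<phi> y u) - \<phi> y (\<phi> x u)"
    and "(\<And>u. u \<in> fin_seqs \<Longrightarrow> \<phi> x u = 0) \<Longrightarrow> x = 0"
  using assms by (simp_all add: weyl_rep_def)

text \<open>Restricting every \<open>\<phi> x\<close> to \<open>fin_seqs\<close> turns the
  representation into an isomorphism onto its image. Faithfulness in \<open>weyl_rep\<close> is
  tested on \<open>fin_seqs\<close> alone for this reason: that is the part of an operator which the
  restriction retains.\<close>

lemma pb_realizedI:
  fixes L :: "'a::ab_group_add lie_alg"
  assumes L: "lie_algebra L" and rep: "weyl_rep L \<phi>"
  shows "pb_realized L"
proof -
  interpret L: lie_algebra L by (rule L)
  define a where "a = (\<lambda>j. fin_op (ann (mode_prime j)))"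
  define b where "b = (\<lambda>j. fin_op (cre (mode_prime j)))"
  define P where "P = pb_lie_algebra seq_scale fin_seqs 3 a b"
  define \<psi> where "\<psi> = (\<lambda>x. restrict_op fin_seqs (\<phi> x))"
  have pb: "ell2.pseudo_bosonic fin_seqs 3 a b"
    unfolding a_def b_def by (rule pseudo_bosonic_modes)
  interpret P: lie_algebra P
    unfolding P_def by (rule ell2.lie_algebra_pb_lie_algebra[OF subspace_fin_seqs pb])
  have scalP: "scal P = (\<lambda>c f x. seq_scale c (f x))"
    and brkP: "brk P = (\<lambda>f g. (f \<circ> g) - (g \<circ> f))"
    by (simp_all add: P_def pb_lie_algebra_def)
  have carrP: "carr P = op_algebra seq_scale fin_seqs (ann ` modes \<union> cre ` modes)"
    unfolding mode_prime(1)[symmetric]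
    by (simp add: P_def pb_lie_algebra_def a_def b_def fin_op_def image_image)
  have W: "\<phi> x \<in> weyl" if "x \<in> carr L" for x
    by (rule weyl_repD(1)[OF rep that])
  have add: "\<psi> (x + y) = \<psi> x + \<psi> y" if "x \<in> carr L" "y \<in> carr L" for x y
    by (auto simp: weyl_repD(2)[OF rep that] \<psi>_def restrict_op_def)
  have scale: "\<psi> (scal L c x) = scal P c (\<psi> x)" if "x \<in> carr L" for x c
    by (auto simp: weyl_repD(3)[OF rep that] \<psi>_def restrict_op_def scalP)
  have brk: "\<psi> (brk L x y) = brk P (\<psi> x) (\<psi> y)" if x: "x \<in> carr L" and y: "y \<in> carr L" for x y
  proof -
    have comp: "restrict_op fin_seqs (\<phi> x \<circ> \<phi> y) = \<psi> x \<circ> \<psi> y"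
      if "x \<in> carr L" "y \<in> carr L" for x y
      unfolding \<psi>_def
      using weyl_closed[OF W[OF that(2)]] seq_pair.linear_0[OF weyl_linear[OF W[OF that(1)]]]
      by (intro restrict_op_comp) auto
    have "\<phi> (brk L x y) = (\<phi> x \<circ> \<phi> y) - (\<phi> y \<circ> \<phi> x)"
      by (rule ext) (simp add: weyl_repD(4)[OF rep x y])
    then have "\<psi> (brk L x y) =
        restrict_op fin_seqs (\<phi> x \<circ> \<phi> y) - restrict_op fin_seqs (\<phi> y \<circ> \<phi> x)"
      by (auto simp: \<psi>_def restrict_op_def fun_eq_iff)
    then show ?thesis by (simp add: comp x y brkP)
  qed
  have inj: "inj_on \<psi> (carr L)"
  proof (rule inj_onI)
    fix x y assume x: "x \<in> carr L" and y: "y \<in> carr L" and eq: "\<psi> x = \<psi> y"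
    have d: "x - y \<in> carr L" using L.subspace_diff[OF L.subspace_carr x y] .
    have "\<phi> (x - y) u = 0" if "u \<in> fin_seqs" for u
    proof -
      \<comment> \<open>Additivity is available for sums only, so \<open>x\<close> is written as
        \<open>x - y + y\<close>.\<close>
      have "\<phi> (x - y + y) u = \<phi> (x - y) u + \<phi> y u"
        by (rule weyl_repD(2)[OF rep d y])
      moreover have "\<phi> x u = \<phi> y u"
        using fun_cong[OF eq, of u] that by (simp add: \<psi>_def restrict_op_def)
      ultimately show ?thesis by simp
    qed
    then have "x - y = 0" by (rule weyl_repD(5)[OF rep d])
    then show "x = y" by simp
  qed
  \<comment> \<open>The image itself serves as the subalgebra \<open>S\<close> in
    \<open>pb_realized\<close>; closure under brackets is pulled back along
    \<open>\<psi>\<close>.\<close>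
  have "\<psi> ` carr L \<subseteq> carr P"
    using W by (auto simp: \<psi>_def carrP weyl_def)
  moreover have "P.subspace (\<psi> ` carr L)"
  proof (rule P.subspaceI)
    show "0 \<in> \<psi> ` carr L"
    proof
      have 0: "0 \<in> carr L" using L.subspace_0[OF L.subspace_carr] .
      from add[OF 0 0] show "0 = \<psi> 0" by simp
      show "0 \<in> carr L" by (rule 0)
    qed
  next
    fix f g assume "f \<in> \<psi> ` carr L" "g \<in> \<psi> ` carr L"
    then obtain x y where "x \<in> carr L" "y \<in> carr L" "f = \<psi> x" "g = \<psi> y" by blast
    then show "f + g \<in> \<psi> ` carr L"
      using L.subspace_add[OF L.subspace_carr] by (metis add imageI)
  next
    fix c f assume "f \<in> \<psi> ` carr L"
    then show "scal P c f \<in> \<psi> ` carr L"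
      using L.subspace_scale[OF L.subspace_carr] by (metis scale imageE imageI)
  qed
  moreover have "brk P f g \<in> \<psi> ` carr L" if "f \<in> \<psi> ` carr L" "g \<in> \<psi> ` carr L" for f g
    using that by (auto simp: brk[symmetric] intro: L.brk_closed)
  ultimately have sub: "lie_subalgebra (\<psi> ` carr L) P"
    by (simp add: lie_subalgebra_def)
  have iso: "lie_isomorphic L (P\<lparr>carr := \<psi> ` carr L\<rparr>)"
    unfolding lie_isomorphic_def using inj
    by (intro exI[of _ \<psi>]) (auto simp: add scale brk bij_betw_def)
  show ?thesis
    unfolding pb_realized_def
    using ell2.complex_hilbert_space_axioms subspace_fin_seqs dense_fin_seqs pb sub iso
    unfolding P_def
    by (intro exI[of _ seq_scale] exI[of _ ell2] exI[of _ ell2_ip] exI[of _ fin_seqs]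
        exI[of _ 3] exI[of _ a] exI[of _ b] exI[of _ "\<psi> ` carr L"]) simp
qed

section \<open>Direct sums, abelian algebras and bracket tables\<close>

text \<open>The last condition makes the powers of \<open>ann 5\<close> above the \<open>k\<close>-th independent of the image
  of \<open>\<phi>\<close>, since \<open>ann 5 ^^ m\<close> sends the basis vector of \<open>5 ^ m\<close> to a nonzero multiple of the vacuum.\<close>

definition free_above :: "nat \<Rightarrow> 'a::ab_group_add lie_alg \<Rightarrow> bool" where
  "free_above k L \<longleftrightarrow> lie_algebra L \<and> (\<exists>\<phi>. weyl_rep L \<phi> \<and>
    (\<forall>x\<in>carr L. \<forall>u. ann 5 (\<phi> x u) = \<phi> x (ann 5 u)) \<and>
    (\<forall>x\<in>carr L. \<forall>m>k. \<phi> x (unit_seq (5 ^ m - 1)) 0 = 0))"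

lemma free_above_realized: "free_above k L \<Longrightarrow> pb_realized L"
  unfolding free_above_def by (blast intro: pb_realizedI)

section \<open>Vacuum coefficients of powers of an annihilation operator\<close>

lemma sum_seq_apply: "(\<Sum>i\<in>I. f i) n = (\<Sum>i\<in>I. f i n)" for f :: "_ \<Rightarrow> nat \<Rightarrow> complex"
  by (induction I rule: infinite_finite_induct) auto

text \<open>Each step lowers \<open>p ^ (j + 1)\<close> to \<open>p ^ j\<close> with factor
  \<open>j + 1\<close>, and the factors multiply to \<open>fact k\<close>. Coordinate 0 stands for
  the integer 1, the vacuum.\<close>

lemma ann_funpow_vacuum:
  assumes "prime p" shows "(ann p ^^ k) u 0 = fact k * u (p ^ k - 1)"
proof (induction k arbitrary: u)
  case (Suc k)
  have p: "p > 1" "p > 0" using prime_gt_1_nat[OF assms] by auto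
  then have 1: "Suc (p ^ k - 1) = p ^ k" by simp
  have "(ann p ^^ Suc k) u 0 = (ann p ^^ k) (ann p u) 0"
    by (simp add: funpow_swap1)
  also have "\<dots> = fact k * (of_nat (Suc k) * u (p * p ^ k - 1))"
    unfolding Suc.IH ann_apply 1 using p by (simp add: multiplicity_same_power)
  finally show ?case by (simp add: mult_ac)
qed simp

text \<open>Testing a combination of powers on one such unit vector therefore isolates a single
  coefficient.\<close>

lemma ann_funpow_vacuum_unit_seq:
  assumes "prime p"
  shows "(ann p ^^ k) (unit_seq (p ^ m - 1)) 0 = (if k = m then fact k else 0)"
proof -
  have p: "p > 1" using prime_gt_1_nat[OF assms] .
  then have "p ^ k > 0" "p ^ m > 0" by auto
  then have "p ^ k - 1 = p ^ m - 1 \<longleftrightarrow> p ^ k = p ^ m" by linarith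
  with p show ?thesis
    by (simp add: ann_funpow_vacuum[OF assms] unit_seq_def)
qed

text \<open>The new summand acts by the first power of \<open>ann 5\<close> beyond \<open>k\<close>.
  This power commutes with the image of \<open>\<phi>\<close>, and the vacuum coefficient on the
  vector of \<open>5 ^ Suc k\<close> reads off its coefficient, since \<open>\<phi>\<close>
  contributes 0 there. Exponents above \<open>Suc k\<close> remain free.\<close>

lemma free_above_sum_i:
  assumes "free_above k L" shows "free_above (Suc k) (L \<oplus>\<^sub>L lie_i)"
proof -
  obtain \<phi> where L: "lie_algebra L" and rep: "weyl_rep L \<phi>"
    and comm: "\<And>x u. x \<in> carr L \<Longrightarrow> ann 5 (\<phi> x u) = \<phi> x (ann 5 u)"
    and van: "\<And>x m. x \<in> carr L \<Longrightarrow> m > k \<Longrightarrow> \<phi> x (unit_seq (5 ^ m - 1)) 0 = 0"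
    using assms unfolding free_above_def by blast
  define Z where "Z = ann 5 ^^ Suc k"
  define \<psi> where "\<psi> = (\<lambda>(p :: 'a \<times> (nat \<Rightarrow> complex)) u. \<phi> (fst p) u + seq_scale (snd p 1) (Z u))"
  have Z: "Z \<in> weyl" unfolding Z_def by (intro weyl_funpow weyl_ann) (simp add: modes_def)
  have comm': "\<phi> x (Z u) = Z (\<phi> x u)" if "x \<in> carr L" for x u
  proof -
    have "\<phi> x ((ann 5 ^^ j) u) = (ann 5 ^^ j) (\<phi> x u)" for j
      by (induction j) (simp_all add: comm[OF that, symmetric])
    then show ?thesis by (simp only: Z_def)
  qed
  have commZ: "ann 5 (Z u) = Z (ann 5 u)" for u
    unfolding Z_def by (simp add: funpow_swap1)
  have five: "prime (5::nat)" by simp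
  \<comment> \<open>An element of \<open>lie_i\<close> is a sequence supported at index 1, so it is
    determined by \<open>snd p 1\<close>.\<close>
  have carr: "p \<in> carr (L \<oplus>\<^sub>L lie_i) \<longleftrightarrow> fst p \<in> carr L \<and> (\<forall>i. i \<noteq> 1 \<longrightarrow> snd p i = 0)" for p
    by (cases p) (auto simp: lie_sum_def lie_i_def table_alg_def)
  have W: "\<phi> x \<in> weyl" if "x \<in> carr L" for x
    by (rule weyl_repD(1)[OF rep that])
  note lin = seq_pair.linear_add[OF weyl_linear] seq_pair.linear_scale[OF weyl_linear]
  have "weyl_rep (L \<oplus>\<^sub>L lie_i) \<psi>"
    unfolding weyl_rep_def
  proof (intro conjI ballI allI impI)
    fix x y :: "'a \<times> (nat \<Rightarrow> complex)" and c u
    assume x: "x \<in> carr (L \<oplus>\<^sub>L lie_i)"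
    then have x1: "fst x \<in> carr L" and x2: "\<And>i. i \<noteq> 1 \<Longrightarrow> snd x i = 0" by (auto simp: carr)
    show "\<psi> x \<in> weyl"
      unfolding \<psi>_def using W[OF x1] Z by (intro weyl_add weyl_scale) auto
    show "\<psi> (scal (L \<oplus>\<^sub>L lie_i) c x) u = seq_scale c (\<psi> x u)"
      by (simp add: weyl_repD(3)[OF rep x1] \<psi>_def lie_sum_def lie_i_def table_alg_def seq.scale_right_distrib)
    show "x = 0" if "\<forall>u\<in>fin_seqs. \<psi> x u = 0"
    proof -
      have "\<psi> x (unit_seq (5 ^ Suc k - 1)) 0 = 0"
        using that unit_seq_fin_seqs by (metis zero_fun_apply)
      moreover have "\<psi> x (unit_seq (5 ^ Suc k - 1)) 0 = snd x 1 * fact (Suc k)"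
        unfolding \<psi>_def using van[OF x1, of "Suc k"] ann_funpow_vacuum_unit_seq[OF five, of "Suc k" "Suc k"]
        by (simp add: seq_scale_def Z_def del: funpow.simps fact_Suc power_Suc)
      ultimately have "snd x 1 = 0" by (simp del: fact_Suc)
      then have "snd x = 0" using x2 by (metis ext zero_fun_apply)
      then have "\<phi> (fst x) u = 0" if "u \<in> fin_seqs" for u
        using \<open>\<forall>u\<in>fin_seqs. \<psi> x u = 0\<close> that by (simp add: \<psi>_def)
      then have "fst x = 0" by (rule weyl_repD(5)[OF rep x1])
      with \<open>snd x = 0\<close> show "x = 0" by (simp add: prod_eq_iff)
    qed
    assume y: "y \<in> carr (L \<oplus>\<^sub>L lie_i)"
    then have y1: "fst y \<in> carr L" by (auto simp: carr)
    show "\<psi> (x + y) u = \<psi> x u + \<psi> y u"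
      by (simp add: weyl_repD(2)[OF rep x1 y1] \<psi>_def seq.scale_left_distrib)
    \<comment> \<open>\<open>lie_i\<close> has an empty bracket table, so the second component of
      the bracket is 0.\<close>
    have "\<psi> (brk (L \<oplus>\<^sub>L lie_i) x y) u = \<phi> (brk L (fst x) (fst y)) u"
      by (simp add: \<psi>_def lie_sum_def lie_i_def table_alg_def)
    also have "\<dots> = \<phi> (fst x) (\<phi> (fst y) u) - \<phi> (fst y) (\<phi> (fst x) u)"
      by (rule weyl_repD(4)[OF rep x1 y1])
    \<comment> \<open>All terms involving \<open>Z\<close> cancel, as \<open>Z\<close> commutes with
      itself and with the image of \<open>\<phi>\<close>.\<close>
    also have "\<dots> = \<psi> x (\<psi> y u) - \<psi> y (\<psi> x u)"
      unfolding \<psi>_def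
      by (simp add: lin[OF W[OF x1]] lin[OF W[OF y1]] lin[OF Z] comm' x1 y1
          seq.scale_right_distrib seq.scale_left_commute)
    finally show "\<psi> (brk (L \<oplus>\<^sub>L lie_i) x y) u = \<psi> x (\<psi> y u) - \<psi> y (\<psi> x u)" .
  qed
  moreover have "ann 5 (\<psi> x u) = \<psi> x (ann 5 u)" if "x \<in> carr (L \<oplus>\<^sub>L lie_i)" for x u
    using that comm
    by (simp add: \<psi>_def carr commZ seq_pair.linear_add[OF seq_linear_ann]
        seq_pair.linear_scale[OF seq_linear_ann])
  moreover have "\<psi> x (unit_seq (5 ^ m - 1)) 0 = 0"
    if "x \<in> carr (L \<oplus>\<^sub>L lie_i)" "m > Suc k" for x m
    using that van[of "fst x" m] ann_funpow_vacuum_unit_seq[OF five, of "Suc k" m]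
    by (simp add: \<psi>_def carr seq_scale_def Z_def del: funpow.simps)
  ultimately show ?thesis
    unfolding free_above_def using lie_algebra_sum[OF L lie_algebra_i] by blast
qed

text \<open>A finite basis is sent to distinct powers of \<open>ann 2\<close>, which commute with
  each other and are linearly independent by their vacuum coefficients.\<close>

lemma abelian_realized:
  fixes A :: "'a::ab_group_add lie_alg"
  assumes A: "lie_algebra A" and fd: "lie_finite_dimensional A" and ab: "lie_abelian A"
  shows "pb_realized A"
proof -
  interpret A: lie_algebra A by (rule A)
  obtain S where S: "finite S" "A.span S = carr A"
    using fd unfolding lie_finite_dimensional_def by blast
  obtain B where B: "B \<subseteq> S" "A.independent B" "S \<subseteq> A.span B"
    using A.maximal_independent_subset[of S] by blast
  have spB: "A.span B = carr A"
    using B S A.span_mono[OF B(1)] A.span_minimal[OF B(3) A.subspace_span] by auto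
  have finB: "finite B" using B(1) S(1) finite_subset by blast
  obtain h :: "'a \<Rightarrow> nat" where h: "inj_on h B"
    using finite_imp_inj_to_nat_seg[OF finB] by auto
  define \<phi> where "\<phi> = (\<lambda>x u. \<Sum>b\<in>B. seq_scale (A.representation B x b) ((ann 2 ^^ h b) u))"
  have Zb: "ann 2 ^^ k \<in> weyl" for k
    by (intro weyl_funpow weyl_ann) (simp add: modes_def)
  have W: "\<phi> x \<in> weyl" for x
    unfolding \<phi>_def using Zb by (intro weyl_sum weyl_scale)
  have two: "prime (2::nat)" by simp
  have "weyl_rep A \<phi>"
    unfolding weyl_rep_def
  proof (intro conjI ballI allI impI W)
    fix x y c u assume x: "x \<in> carr A"
    show "\<phi> (scal A c x) u = seq_scale c (\<phi> x u)"
      using x B(2) spB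
      by (simp add: \<phi>_def A.representation_scale seq.scale_sum_right)
    show "x = 0" if "\<forall>u\<in>fin_seqs. \<phi> x u = 0"
    proof -
      have "A.representation B x b = 0" if b: "b \<in> B" for b
      proof -
        \<comment> \<open>Injectivity of \<open>h\<close> leaves only the term of \<open>b\<close>
          on the vector of \<open>2 ^ h b\<close>.\<close>
        have "\<phi> x (unit_seq (2 ^ h b - 1)) 0 =
            (\<Sum>b'\<in>B. if b' = b then A.representation B x b * fact (h b) else 0)"
          unfolding \<phi>_def sum_seq_apply
          using inj_on_eq_iff[OF h _ b]
          by (intro sum.cong) (auto simp: seq_scale_def ann_funpow_vacuum_unit_seq[OF two] simp del: One_nat_def)
        also have "\<dots> = A.representation B x b * fact (h b)"
          using finB b by simp
        finally show ?thesis
          using \<open>\<forall>u\<in>fin_seqs. \<phi> x u = 0\<close> unit_seq_fin_seqs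
          by (metis zero_fun_apply fact_nonzero mult_eq_0_iff)
      qed
      then show "x = 0"
        using A.sum_representation_eq[OF B(2), of x B] x spB finB by simp
    qed
    assume y: "y \<in> carr A"
    show "\<phi> (x + y) u = \<phi> x u + \<phi> y u"
      using x y B(2) spB
      by (simp add: \<phi>_def A.representation_add seq.scale_left_distrib sum.distrib)
    \<comment> \<open>In the expanded product the exponents add, so interchanging the two sums
      exchanges the roles of \<open>x\<close> and \<open>y\<close>.\<close>
    have expand: "\<phi> x (\<phi> y u) = (\<Sum>b\<in>B. \<Sum>b'\<in>B.
        seq_scale (A.representation B x b * A.representation B y b') ((ann 2 ^^ (h b + h b')) u))" for x y
      unfolding \<phi>_def
      unfolding seq_pair.linear_sum[OF weyl_linear[OF Zb]]
        seq_pair.linear_scale[OF weyl_linear[OF Zb]] seq.scale_sum_right seq.scale_scale funpow_add comp_apply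
      by (rule refl)
    have "\<phi> x (\<phi> y u) = \<phi> y (\<phi> x u)"
      unfolding expand by (subst sum.swap) (simp only: mult.commute add.commute)
    moreover have "\<phi> 0 u = 0" by (simp add: \<phi>_def A.representation_zero)
    ultimately show "\<phi> (brk A x y) u = \<phi> x (\<phi> y u) - \<phi> y (\<phi> x u)"
      using ab x y by (simp add: lie_abelian_def)
  qed
  then show ?thesis by (rule pb_realizedI[OF A])
qed

text \<open>The assignment of \<open>V i\<close> to \<open>v i\<close> is extended linearly;
  antisymmetry makes the relations for \<open>i < j\<close> sufficient. The operators used below
  read at the vacuum at most the coordinates 0, 1 and 2, and \<open>5 ^ m - 1\<close> is at least 4
  for positive \<open>m\<close>; hence the bound \<open>k > 2\<close> and the index 0 in the
  conclusion.\<close>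

lemma free_above_table:
  assumes T: "\<And>i j l. (i, j, l) \<in> T \<Longrightarrow> 1 \<le> i \<and> i < j \<and> j \<le> n \<and> l \<in> {1..n}"
    and L: "lie_algebra (table_alg n T)"
    and V: "\<And>i. i \<in> {1..n} \<Longrightarrow> V i \<in> weyl"
    and rel: "\<And>i j u. 1 \<le> i \<Longrightarrow> i < j \<Longrightarrow> j \<le> n \<Longrightarrow>
      V i (V j u) - V j (V i u) = (\<Sum>(i', j', l)\<in>T. if i' = i \<and> j' = j then V l u else 0)"
    and comm: "\<And>i u. i \<in> {1..n} \<Longrightarrow> ann 5 (V i u) = V i (ann 5 u)"
    and van: "\<And>i k. i \<in> {1..n} \<Longrightarrow> k > 2 \<Longrightarrow> V i (unit_seq k) 0 = 0"
    and indep: "\<And>x. (\<And>k m. (\<Sum>i=1..n. x i * V i (unit_seq k) m) = 0) \<Longrightarrow>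
      \<forall>i\<in>{1..n}. x i = 0"
  shows "free_above 0 (table_alg n T)"
proof -
  define \<phi> where "\<phi> = (\<lambda>x u. \<Sum>i=1..n. seq_scale (x i) (V i u))"
  have W: "\<phi> x \<in> weyl" for x
    unfolding \<phi>_def using V by (intro weyl_sum weyl_scale)
  have "\<phi> (brk (table_alg n T) x y) u = \<phi> x (\<phi> y u) - \<phi> y (\<phi> x u)" for x y u
  proof
    fix m
    \<comment> \<open>\<open>d t i j\<close> indicates that the table entry \<open>t\<close> lists
      the pair \<open>(i, j)\<close>; its antisymmetrization \<open>E\<close> supplies the structure
      constants for both orders of the pair.\<close>
    define d :: "nat \<times> nat \<times> nat \<Rightarrow> nat \<Rightarrow> nat \<Rightarrow> complex" where
      "d = (\<lambda>(i', j', l) i j. if i' = i \<and> j' = j then 1 else 0)"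
    define E where "E = (\<lambda>t i j. d t i j - d t j i)"
    have C: "(V i (V j u) - V j (V i u)) m = (\<Sum>(i', j', l)\<in>T. E (i', j', l) i j * V l u m)"
      if ij: "i \<in> {1..n}" "j \<in> {1..n}" for i j
    proof -
      have *: "(V i (V j u) - V j (V i u)) m = (\<Sum>(i', j', l)\<in>T. E (i', j', l) i j * V l u m)"
        if "1 \<le> i" "i < j" "j \<le> n" for i j
        unfolding rel[OF that] sum_seq_apply
      proof (intro sum.cong refl, clarify)
        fix i' j' l assume "(i', j', l) \<in> T"
        \<comment> \<open>Entries have increasing indices, so the transposed indicator in
          \<open>E\<close> vanishes for \<open>i < j\<close>.\<close>
        then have "i' < j'" using T by blast
        with \<open>i < j\<close> show "(if i' = i \<and> j' = j then V l u else 0) m = E (i', j', l) i j * V l u m"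
          by (simp add: E_def d_def)
      qed
      consider "i < j" | "i = j" | "j < i" by linarith
      then show ?thesis
      proof cases
        case 2
        have "E t j j = 0" for t by (simp add: E_def)
        then show ?thesis unfolding 2 by simp
      next
        case 3
        have anti: "(\<Sum>(i', j', l)\<in>T. E (i', j', l) i j * V l u m) =
            - (\<Sum>(i', j', l)\<in>T. E (i', j', l) j i * V l u m)"
          unfolding sum_negf[symmetric]
        proof (intro sum.cong refl, clarify)
          fix i' j' l
          show "E (i', j', l) i j * V l u m = - (E (i', j', l) j i * V l u m)"
            by (simp add: E_def left_diff_distrib)
        qed
        have "(V j (V i u) - V i (V j u)) m = (\<Sum>(i', j', l)\<in>T. E (i', j', l) j i * V l u m)"
          by (rule *) (use 3 ij in auto)
        from this[symmetric] show ?thesis unfolding anti by simp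
      next
        case 1
        with * ij show ?thesis by simp
      qed
    qed
    have comp: "\<phi> x (\<phi> y u) m = (\<Sum>i=1..n. \<Sum>j=1..n. x i * y j * V i (V j u) m)" for x y
    proof -
      have "V i (\<phi> y u) m = (\<Sum>j=1..n. y j * V i (V j u) m)" if "i \<in> {1..n}" for i
        unfolding \<phi>_def
        by (simp add: seq_pair.linear_sum[OF weyl_linear[OF V[OF that]]]
            seq_pair.linear_scale[OF weyl_linear[OF V[OF that]]] sum_seq_apply)
          (simp add: seq_scale_def)
      then show ?thesis
        unfolding \<phi>_def by (simp add: sum_seq_apply seq_scale_def sum_distrib_left mult_ac \<phi>_def)
    qed
    have "(\<phi> x (\<phi> y u) - \<phi> y (\<phi> x u)) m =
        (\<Sum>i=1..n. \<Sum>j=1..n. x i * y j * (V i (V j u) - V j (V i u)) m)"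
    proof -
      have "\<phi> y (\<phi> x u) m = (\<Sum>i=1..n. \<Sum>j=1..n. x i * y j * V j (V i u) m)"
        unfolding comp by (subst sum.swap) (simp add: mult_ac)
      then show ?thesis by (simp add: comp sum_subtractf right_diff_distrib)
    qed
    also have "\<dots> = (\<Sum>i=1..n. \<Sum>j=1..n. \<Sum>(i', j', l)\<in>T. x i * y j * (E (i', j', l) i j * V l u m))"
      by (intro sum.cong refl) (simp add: C sum_distrib_left case_prod_unfold del: minus_apply)
    also have "\<dots> = (\<Sum>(i', j', l)\<in>T. \<Sum>i=1..n. \<Sum>j=1..n. x i * y j * (E (i', j', l) i j * V l u m))"
      unfolding case_prod_unfold
      by (subst (2) sum.swap, subst sum.swap) (rule refl)
    also have "\<dots> = (\<Sum>(i', j', l)\<in>T. (x i' * y j' - x j' * y i') * V l u m)"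
    proof (intro sum.cong refl, clarify)
      fix i' j' l assume t: "(i', j', l) \<in> T"
      \<comment> \<open>Conditionals nested on \<open>j\<close> and then on \<open>i\<close> give
        both indicator sums the shape that \<open>sum.delta\<close> collapses.\<close>
      have "(\<Sum>i=1..n. \<Sum>j=1..n. x i * y j * (E (i', j', l) i j * V l u m)) =
          (\<Sum>i=1..n. \<Sum>j=1..n. if j' = j then if i' = i then x i * y j * V l u m else 0 else 0) -
          (\<Sum>i=1..n. \<Sum>j=1..n. if i' = j then if j' = i then x i * y j * V l u m else 0 else 0)"
        unfolding sum_subtractf[symmetric]
        by (intro sum.cong refl) (auto simp: E_def d_def)
      also have "\<dots> = (x i' * y j' - x j' * y i') * V l u m"
        using T[OF t] by (simp add: sum.delta algebra_simps)
      finally show "(\<Sum>i=1..n. \<Sum>j=1..n. x i * y j * (E (i', j', l) i j * V l u m)) =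
        (x i' * y j' - x j' * y i') * V l u m" .
    qed
    \<comment> \<open>The index \<open>l\<close> becomes a delta sum over \<open>k\<close>, so that
      exchanging the sums yields the coordinates of the bracket.\<close>
    also have "\<dots> = (\<Sum>(i, j, l)\<in>T. \<Sum>k=1..n. if l = k then (x i * y j - x j * y i) * V k u m else 0)"
      using T by (intro sum.cong refl) (auto simp: sum.delta)
    also have "\<dots> = (\<Sum>k=1..n. \<Sum>(i, j, l)\<in>T. if l = k then (x i * y j - x j * y i) * V k u m else 0)"
      unfolding case_prod_unfold by (rule sum.swap)
    also have "\<dots> = \<phi> (brk (table_alg n T) x y) u m"
      unfolding \<phi>_def sum_seq_apply
      by (intro sum.cong refl)
        (auto simp: table_alg_def seq_scale_def sum_distrib_right case_prod_unfold intro!: sum.cong)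
    finally show "\<phi> (brk (table_alg n T) x y) u m = (\<phi> x (\<phi> y u) - \<phi> y (\<phi> x u)) m" by simp
  qed
  moreover have "x = 0" if "x \<in> carr (table_alg n T)" "\<forall>u\<in>fin_seqs. \<phi> x u = 0" for x
  proof
    fix i
    have "\<forall>i\<in>{1..n}. x i = 0"
    proof (rule indep)
      fix k m
      have "\<phi> x (unit_seq k) m = 0" using that(2) unit_seq_fin_seqs by (metis zero_fun_apply)
      then show "(\<Sum>i=1..n. x i * V i (unit_seq k) m) = 0"
        by (simp add: \<phi>_def sum_seq_apply seq_scale_def)
    qed
    then show "x i = 0 i" using that(1) by (auto simp: table_alg_def)
  qed
  moreover have "\<phi> (x + y) u = \<phi> x u + \<phi> y u" for x y u
    by (simp add: \<phi>_def seq.scale_left_distrib sum.distrib)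
  moreover have "\<phi> (scal (table_alg n T) c x) u = seq_scale c (\<phi> x u)" for c x u
    by (simp add: \<phi>_def table_alg_def seq.scale_sum_right)
  ultimately have "weyl_rep (table_alg n T) \<phi>"
    using W unfolding weyl_rep_def by blast
  moreover have "ann 5 (\<phi> x u) = \<phi> x (ann 5 u)" for x u
    unfolding \<phi>_def
    by (simp add: seq_pair.linear_sum[OF seq_linear_ann] seq_pair.linear_scale[OF seq_linear_ann] comm)
  moreover have "\<phi> x (unit_seq (5 ^ m - 1)) 0 = 0" if "m > 0" for x m
  proof -
    have "(5::nat) ^ 1 \<le> 5 ^ m" using that by (intro power_increasing) auto
    then show ?thesis using van by (simp add: \<phi>_def sum_seq_apply seq_scale_def)
  qed
  ultimately show ?thesis
    unfolding free_above_def using L by blast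
qed

section \<open>The realizations\<close>

text \<open>Oriented for normal ordering: rewriting moves creation operators outward past
  annihilation operators, and smaller primes outward within each kind.\<close>

lemma weyl_relations:
  "ann 2 (cre 2 u) = cre 2 (ann 2 u) + u" "ann 3 (cre 3 u) = cre 3 (ann 3 u) + u"
  "ann 2 (cre 3 u) = cre 3 (ann 2 u)" "ann 3 (cre 2 u) = cre 2 (ann 3 u)"
  "ann 5 (cre 2 u) = cre 2 (ann 5 u)" "ann 5 (cre 3 u) = cre 3 (ann 5 u)"
  "ann 3 (ann 2 u) = ann 2 (ann 3 u)" "ann 5 (ann 2 u) = ann 2 (ann 5 u)"
  "ann 5 (ann 3 u) = ann 3 (ann 5 u)" "cre 3 (cre 2 u) = cre 2 (cre 3 u)"
proof -
  have p: "prime (2::nat)" "prime (3::nat)" "prime (5::nat)" by simp_all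
  show "ann 2 (cre 2 u) = cre 2 (ann 2 u) + u" "ann 3 (cre 3 u) = cre 3 (ann 3 u) + u"
    by (rule ann_cre_same, rule p)+
  show "ann 2 (cre 3 u) = cre 3 (ann 2 u)" "ann 3 (cre 2 u) = cre 2 (ann 3 u)"
    "ann 5 (cre 2 u) = cre 2 (ann 5 u)" "ann 5 (cre 3 u) = cre 3 (ann 5 u)"
    by (rule ann_cre_distinct; simp)+
  show "ann 3 (ann 2 u) = ann 2 (ann 3 u)" "ann 5 (ann 2 u) = ann 2 (ann 5 u)"
    "ann 5 (ann 3 u) = ann 3 (ann 5 u)"
    by (rule ann_ann_distinct; simp)+
  show "cre 3 (cre 2 u) = cre 2 (cre 3 u)"
    by (rule cre_cre_commute; simp)
qed

text \<open>Moving \<open>ann 2\<close> past \<open>cre 2 (cre 2 u)\<close> produces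
  \<open>cre 2 u\<close> twice; the factor one half makes the commutator equal to
  \<open>cre 2\<close>.\<close>

lemma seq_scale_half: "seq_scale (1 / 2) (2 * u + v) - seq_scale (1 / 2) v = u"
  by (simp add: seq_scale_def fun_eq_iff field_simps)

lemmas weyl_simps = weyl_relations seq_scale_half
  seq_pair.linear_add[OF seq_linear_ann] seq_pair.linear_scale[OF seq_linear_ann]
  seq_pair.linear_add[OF seq_linear_cre] seq_pair.linear_scale[OF seq_linear_cre]

lemma multiplicity_Suc_0: "multiplicity p (Suc 0) = 0" for p :: nat
  using multiplicity_one[of p] by simp

lemmas vacuum_simps = ann_apply cre_apply unit_seq_def seq_scale_def multiplicity_Suc_0
  numeral_2_eq_2[symmetric]

lemma mode_mem: "2 \<in> modes" "3 \<in> modes" "5 \<in> modes"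
  by (auto simp: modes_def)

lemma weyl_words:
  "ann 2 \<in> weyl" "ann 3 \<in> weyl" "cre 2 \<in> weyl" "cre 3 \<in> weyl"
  "(\<lambda>u. cre 2 (cre 3 u)) \<in> weyl"
  "(\<lambda>u. seq_scale (1 / 2) (cre 2 (cre 2 u))) \<in> weyl"
  "(\<lambda>u. seq_scale (1 / 2) (cre 2 (cre 2 u)) + ann 3 u) \<in> weyl"
proof -
  show *: "ann 2 \<in> weyl" "ann 3 \<in> weyl" "cre 2 \<in> weyl" "cre 3 \<in> weyl"
    by (simp_all add: weyl_ann weyl_cre mode_mem)
  show "(\<lambda>u. cre 2 (cre 3 u)) \<in> weyl" by (rule weyl_comp[OF *(3,4)])
  show **: "(\<lambda>u. seq_scale (1 / 2) (cre 2 (cre 2 u))) \<in> weyl"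
    by (rule weyl_scale[OF weyl_comp[OF *(3,3)]])
  show "(\<lambda>u. seq_scale (1 / 2) (cre 2 (cre 2 u)) + ann 3 u) \<in> weyl"
    by (rule weyl_add[OF ** *(2)])
qed

lemma atLeastAtMost_1_3: "{1..3::nat} = {1, 2, 3}"
  and atLeastAtMost_1_4: "{1..4::nat} = {1, 2, 3, 4}"
  and atLeastAtMost_1_5: "{1..5::nat} = {1, 2, 3, 4, 5}"
  by auto

text \<open>The finite list turns each check of bracket relations, also in dimensions 3 and 4, into
  concrete pairs.\<close>

lemma less_le_5_cases:
  fixes i j :: nat
  assumes "1 \<le> i" "i < j" "j \<le> 5"
  shows "(i, j) \<in> {(1, 2), (1, 3), (1, 4), (1, 5), (2, 3), (2, 4), (2, 5), (3, 4), (3, 5), (4, 5)}"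
proof -
  have "i = 1 \<or> i = 2 \<or> i = 3 \<or> i = 4" "j = 2 \<or> j = 3 \<or> j = 4 \<or> j = 5"
    using assms by linarith+
  with \<open>i < j\<close> show ?thesis by (elim disjE) simp_all
qed

section \<open>Explicit operators for the indecomposable algebras\<close>

lemma free_above_h1: "free_above 0 (lie_h 1)"
proof -
  \<comment> \<open>indices start at 1, so the head of the list is padding\<close>
  define V where "V = nth [id, ann 2, cre 2, id]"
  have V: "V 1 = ann 2" "V 2 = cre 2" "V 3 = id"
    by (simp_all add: V_def)
  have eq: "(lie_h 1) = table_alg 3 {(1, 2, 3)}"
    by (simp add: lie_h_def)
  show ?thesis
    unfolding eq
  proof (rule free_above_table)
    show "lie_algebra (table_alg 3 {(1, 2, 3)})"
      using lie_algebra_h[of 1] by (simp only: eq)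
    fix i j u assume ij: "1 \<le> i" "i < j" "j \<le> (3::nat)"
    show "V i (V j u) - V j (V i u) =
        (\<Sum>(i', j', l)\<in>{(1, 2, 3)}. if i' = i \<and> j' = j then V l u else 0)"
      using less_le_5_cases[of i j] ij by (auto simp: V weyl_simps simp del: One_nat_def)
  next
    fix x :: "nat \<Rightarrow> complex"
    assume *: "\<And>k m. (\<Sum>i=1..3. x i * V i (unit_seq k) m) = 0"
    \<comment> \<open>\<open>*[of k m]\<close> tests the matrix entry from vector \<open>k\<close>
      to coordinate \<open>m\<close>: the entry at the vacuum isolates \<open>id\<close>, coordinate
      1 (the integer 2) isolates \<open>cre 2\<close>, and \<open>ann 2\<close> sends vector 1 to
      the vacuum.\<close>
    show "\<forall>i\<in>{1..3}. x i = 0"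
      using *[of 0 0] *[of 0 1] *[of 1 0]
      unfolding atLeastAtMost_1_3 by (simp add: V V[unfolded One_nat_def] vacuum_simps)
  next
    fix i assume i: "i \<in> {1..3::nat}"
    show "V i \<in> weyl"
      using i unfolding atLeastAtMost_1_3
      by (auto simp: V weyl_words weyl_id simp del: One_nat_def)
    show "ann 5 (V i u) = V i (ann 5 u)" for u
      using i unfolding atLeastAtMost_1_3 by (auto simp: V weyl_simps simp del: One_nat_def)
    show "V i (unit_seq k) 0 = 0" if "k > 2" for k
      using i that unfolding atLeastAtMost_1_3
      by (auto simp: V V[unfolded One_nat_def] vacuum_simps)
  qed auto
qed

text \<open>Different modes commute, and within each mode the commutator is the same central
  element, the identity.\<close>

lemma free_above_h2: "free_above 0 (lie_h 2)"
proof -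
  define V where "V = nth [id, ann 2, cre 2, ann 3, cre 3, id]"
  have V: "V 1 = ann 2" "V 2 = cre 2" "V 3 = ann 3" "V 4 = cre 3" "V 5 = id"
    by (simp_all add: V_def)
  have eq: "(lie_h 2) = table_alg 5 {(1, 2, 5), (3, 4, 5)}"
    by (simp add: lie_h_def eval_nat_numeral atLeastAtMostSuc_conv insert_commute)
  show ?thesis
    unfolding eq
  proof (rule free_above_table)
    show "lie_algebra (table_alg 5 {(1, 2, 5), (3, 4, 5)})"
      using lie_algebra_h[of 2] by (simp only: eq)
    fix i j u assume ij: "1 \<le> i" "i < j" "j \<le> (5::nat)"
    show "V i (V j u) - V j (V i u) =
        (\<Sum>(i', j', l)\<in>{(1, 2, 5), (3, 4, 5)}. if i' = i \<and> j' = j then V l u else 0)"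
      using less_le_5_cases[of i j] ij by (auto simp: V weyl_simps simp del: One_nat_def)
  next
    fix x :: "nat \<Rightarrow> complex"
    assume *: "\<And>k m. (\<Sum>i=1..5. x i * V i (unit_seq k) m) = 0"
    show "\<forall>i\<in>{1..5}. x i = 0"
      using *[of 0 0] *[of 0 1] *[of 0 2] *[of 1 0] *[of 2 0]
      unfolding atLeastAtMost_1_5 by (simp add: V V[unfolded One_nat_def] vacuum_simps)
  next
    fix i assume i: "i \<in> {1..5::nat}"
    show "V i \<in> weyl"
      using i unfolding atLeastAtMost_1_5
      by (auto simp: V weyl_words weyl_id simp del: One_nat_def)
    show "ann 5 (V i u) = V i (ann 5 u)" for u
      using i unfolding atLeastAtMost_1_5 by (auto simp: V weyl_simps simp del: One_nat_def)
    show "V i (unit_seq k) 0 = 0" if "k > 2" for k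
      using i that unfolding atLeastAtMost_1_5
      by (auto simp: V V[unfolded One_nat_def] vacuum_simps)
  qed auto
qed

text \<open>Commutation with \<open>ann 2\<close> differentiates in \<open>cre 2\<close>, giving the
  chain from half the square of \<open>cre 2\<close> to \<open>cre 2\<close> to the
  identity.\<close>

lemma free_above_l43: "free_above 0 lie_l43"
proof -
  define V where "V = nth [id, ann 2, (\<lambda>u. seq_scale (1 / 2) (cre 2 (cre 2 u))), cre 2, id]"
  have V: "V 1 = ann 2" "V 2 = (\<lambda>u. seq_scale (1 / 2) (cre 2 (cre 2 u)))" "V 3 = cre 2" "V 4 = id"
    by (simp_all add: V_def)
  have eq: "lie_l43 = table_alg 4 {(1, 2, 3), (1, 3, 4)}"
    by (simp add: lie_l43_def)
  show ?thesis
    unfolding eq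
  proof (rule free_above_table)
    show "lie_algebra (table_alg 4 {(1, 2, 3), (1, 3, 4)})"
      using lie_algebra_l43 by (simp only: eq)
    fix i j u assume ij: "1 \<le> i" "i < j" "j \<le> (4::nat)"
    show "V i (V j u) - V j (V i u) =
        (\<Sum>(i', j', l)\<in>{(1, 2, 3), (1, 3, 4)}. if i' = i \<and> j' = j then V l u else 0)"
      using less_le_5_cases[of i j] ij by (auto simp: V weyl_simps simp del: One_nat_def)
  next
    fix x :: "nat \<Rightarrow> complex"
    assume *: "\<And>k m. (\<Sum>i=1..4. x i * V i (unit_seq k) m) = 0"
    \<comment> \<open>Coordinate 3 stands for the integer 4 and detects the square of
      \<open>cre 2\<close>.\<close>
    show "\<forall>i\<in>{1..4}. x i = 0"
      using *[of 0 0] *[of 0 1] *[of 0 3] *[of 1 0]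
      unfolding atLeastAtMost_1_4 by (simp add: V V[unfolded One_nat_def] vacuum_simps)
  next
    fix i assume i: "i \<in> {1..4::nat}"
    show "V i \<in> weyl"
      using i unfolding atLeastAtMost_1_4
      by (auto simp: V weyl_words weyl_id simp del: One_nat_def)
    show "ann 5 (V i u) = V i (ann 5 u)" for u
      using i unfolding atLeastAtMost_1_4 by (auto simp: V weyl_simps simp del: One_nat_def)
    show "V i (unit_seq k) 0 = 0" if "k > 2" for k
      using i that unfolding atLeastAtMost_1_4
      by (auto simp: V V[unfolded One_nat_def] vacuum_simps)
  qed auto
qed

text \<open>Adding \<open>ann 3\<close> to the second generator used for \<open>lie_l43\<close>
  gives it commutator 1 with \<open>cre 3\<close> and leaves its brackets with \<open>ann 2\<close>
  and \<open>cre 2\<close> unchanged.\<close>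

lemma free_above_l55: "free_above 0 lie_l55"
proof -
  define V where "V = nth [id, ann 2, (\<lambda>u. seq_scale (1 / 2) (cre 2 (cre 2 u)) + ann 3 u), cre 2, cre 3, id]"
  have V: "V 1 = ann 2" "V 2 = (\<lambda>u. seq_scale (1 / 2) (cre 2 (cre 2 u)) + ann 3 u)" "V 3 = cre 2" "V 4 = cre 3" "V 5 = id"
    by (simp_all add: V_def)
  have eq: "lie_l55 = table_alg 5 {(1, 2, 3), (1, 3, 5), (2, 4, 5)}"
    by (simp add: lie_l55_def)
  show ?thesis
    unfolding eq
  proof (rule free_above_table)
    show "lie_algebra (table_alg 5 {(1, 2, 3), (1, 3, 5), (2, 4, 5)})"
      using lie_algebra_l55 by (simp only: eq)
    fix i j u assume ij: "1 \<le> i" "i < j" "j \<le> (5::nat)"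
    show "V i (V j u) - V j (V i u) =
        (\<Sum>(i', j', l)\<in>{(1, 2, 3), (1, 3, 5), (2, 4, 5)}. if i' = i \<and> j' = j then V l u else 0)"
      using less_le_5_cases[of i j] ij by (auto simp: V weyl_simps simp del: One_nat_def)
  next
    fix x :: "nat \<Rightarrow> complex"
    assume *: "\<And>k m. (\<Sum>i=1..5. x i * V i (unit_seq k) m) = 0"
    show "\<forall>i\<in>{1..5}. x i = 0"
      using *[of 0 0] *[of 0 1] *[of 0 2] *[of 0 3] *[of 1 0]
      unfolding atLeastAtMost_1_5 by (simp add: V V[unfolded One_nat_def] vacuum_simps)
  next
    fix i assume i: "i \<in> {1..5::nat}"
    show "V i \<in> weyl"
      using i unfolding atLeastAtMost_1_5
      by (auto simp: V weyl_words weyl_id simp del: One_nat_def)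
    show "ann 5 (V i u) = V i (ann 5 u)" for u
      using i unfolding atLeastAtMost_1_5 by (auto simp: V weyl_simps simp del: One_nat_def)
    show "V i (unit_seq k) 0 = 0" if "k > 2" for k
      using i that unfolding atLeastAtMost_1_5
      by (auto simp: V V[unfolded One_nat_def] vacuum_simps)
  qed auto
qed

text \<open>\<open>cre 3\<close> behaves as a scalar for mode 2, so commuting \<open>ann 2\<close>
  with \<open>cre 2\<close> and with \<open>cre 2 (cre 3 u)\<close> gives two independent central
  elements, \<open>id\<close> and \<open>cre 3\<close>.\<close>

lemma free_above_l58: "free_above 0 lie_l58"
proof -
  define V where "V = nth [id, ann 2, cre 2, (\<lambda>u. cre 2 (cre 3 u)), id, cre 3]"
  have V: "V 1 = ann 2" "V 2 = cre 2" "V 3 = (\<lambda>u. cre 2 (cre 3 u))" "V 4 = id" "V 5 = cre 3"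
    by (simp_all add: V_def)
  have eq: "lie_l58 = table_alg 5 {(1, 2, 4), (1, 3, 5)}"
    by (simp add: lie_l58_def)
  show ?thesis
    unfolding eq
  proof (rule free_above_table)
    show "lie_algebra (table_alg 5 {(1, 2, 4), (1, 3, 5)})"
      using lie_algebra_l58 by (simp only: eq)
    fix i j u assume ij: "1 \<le> i" "i < j" "j \<le> (5::nat)"
    show "V i (V j u) - V j (V i u) =
        (\<Sum>(i', j', l)\<in>{(1, 2, 4), (1, 3, 5)}. if i' = i \<and> j' = j then V l u else 0)"
      using less_le_5_cases[of i j] ij by (auto simp: V weyl_simps simp del: One_nat_def)
  next
    fix x :: "nat \<Rightarrow> complex"
    assume *: "\<And>k m. (\<Sum>i=1..5. x i * V i (unit_seq k) m) = 0"
    \<comment> \<open>Coordinate 5 stands for the integer 6 and detects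
      \<open>cre 2 (cre 3 u)\<close>.\<close>
    show "\<forall>i\<in>{1..5}. x i = 0"
      using *[of 0 0] *[of 0 1] *[of 0 2] *[of 0 5] *[of 1 0]
      unfolding atLeastAtMost_1_5 by (simp add: V V[unfolded One_nat_def] vacuum_simps)
  next
    fix i assume i: "i \<in> {1..5::nat}"
    show "V i \<in> weyl"
      using i unfolding atLeastAtMost_1_5
      by (auto simp: V weyl_words weyl_id simp del: One_nat_def)
    show "ann 5 (V i u) = V i (ann 5 u)" for u
      using i unfolding atLeastAtMost_1_5 by (auto simp: V weyl_simps simp del: One_nat_def)
    show "V i (unit_seq k) 0 = 0" if "k > 2" for k
      using i that unfolding atLeastAtMost_1_5
      by (auto simp: V V[unfolded One_nat_def] vacuum_simps)
  qed auto
qed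

theorem theorem3p2:
  shows "(\<forall>A :: 'a::ab_group_add lie_alg.
            lie_algebra A \<and> lie_finite_dimensional A \<and> lie_abelian A \<longrightarrow> pb_realized A)
    \<and> pb_realized (lie_h 1)
    \<and> pb_realized lie_l42
    \<and> pb_realized lie_l52
    \<and> (pb_realized (lie_l52 \<oplus>\<^sub>L lie_i) \<and> pb_realized lie_l43 \<and> pb_realized lie_l58)
    \<and> (pb_realized lie_l72 \<and> pb_realized (lie_h 2))
    \<and> (pb_realized (lie_l43 \<oplus>\<^sub>L lie_i) \<and> pb_realized lie_l55 \<and> pb_realized (lie_h 2 \<oplus>\<^sub>L lie_i)
       \<and> pb_realized (lie_l58 \<oplus>\<^sub>L lie_i) \<and> pb_realized lie_l82)"
proof -
  note * = free_above_h1 free_above_h2 free_above_l43 free_above_l55 free_above_l58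
  note ** = *[THEN free_above_sum_i]
  \<comment> \<open>Each added copy of \<open>lie_i\<close> uses the next power of
    \<open>ann 5\<close>, so the index grows from 1 for \<open>lie_l42\<close> to 5 for
    \<open>lie_l82\<close>.\<close>
  have l42: "free_above 1 lie_l42"
    unfolding lie_l42_def using **(1) by simp
  note l52 = free_above_sum_i[OF l42, folded lie_l52_def]
  note l52i = free_above_sum_i[OF l52]
  note l72 = free_above_sum_i[OF l52i, folded lie_l72_def]
  note l82 = free_above_sum_i[OF l72, folded lie_l82_def]
  show ?thesis
    using abelian_realized free_above_realized[OF l42] free_above_realized[OF l52]
      free_above_realized[OF l52i] free_above_realized[OF l72] free_above_realized[OF l82]
      *[THEN free_above_realized] **[THEN free_above_realized]
    by blast
qed

end
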